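(* Let $(\mathrm{H},\mathrm{D.A})$ be any of the pairs $(\mathrm{H.TQBA},\mathrm{D.TQBA})$, $(\mathrm{H.TQBA5},\mathrm{D.TQBA5})$, $(\mathrm{H.IA1},\mathrm{D.IA1})$, $(\mathrm{H.IA2},\mathrm{D.IA2})$, $(\mathrm{H.IA3},\mathrm{D.IA3})$, $(\mathrm{H.PRA},\mathrm{D.PRA})$. Then $\mathrm{D.A}$ is conservative with respect to $\mathrm{H}$: for all $\mathcal{L}$-formulas $A$ and $B$, if $A^\tau\vdash B^\tau$ is derivable in $\mathrm{D.A}$, then $A\vdash B$ is derivable in $\mathrm{H}$.
   Context: **The logics H.** Formulas of $\mathcal{L}$: $A::=p\mid\top\mid\bot\mid\neg A\mid IA\mid CA\mid A\land A\mid A\lor A$, with $p$ from a denumerable set of propositional variables. Sequents are $A\vdash B$ with $A,B$ formulas. De Morgan logic has axioms $A\vdash A$, $\bot\vdash A$, $A\vdash\top$, $A\land B\vdash A$, $A\land B\vdash B$, $A\vdash A\lor B$, $B\vdash A\lor B$, $A\land(B\lor E)\vdash(A\land B)\lor(A\land E)$, $A\vdash\neg\neg A$, $\neg\neg A\vdash A$, and rules: from $A\vdash B$ and $B\vdash E$ infer $A\vdash E$; from $A\vdash B$ and $A\vdash E$ infer $A\vdash B\land E$; from $A\vdash E$ and $B\vdash E$ infer $A\lor B\vdash E$; from $A\vdash B$ infer $\neg B\vdash\neg A$. $\mathrm{H.TQBA}$ adds to De Morgan logic the axioms $IA\vdash A$, $IA\vdash IIA$, $I(A\land B)\vdash IA\land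 IB$, $IA\land IB\vdash I(A\land B)$, $\top\vdash I\top$, $CA\vdash\neg I\neg A$, $\neg I\neg A\vdash CA$, $\neg C\neg A\vdash IA$, $IA\vdash\neg C\neg A$, and the monotonicity rule from $A\vdash B$ infer $IA\vdash IB$. Consider: (1) $CIA\vdash IA$; (2) $\top\vdash IA\lor\neg IA$; (3) $I(A\lor B)\vdash IA\lor IB$; (4) the rule: from $IA\vdash IB$ and $CA\vdash CB$ infer $A\vdash B$. $\mathrm{H.TQBA5}$, $\mathrm{H.IA1}$, $\mathrm{H.IA2}$, $\mathrm{H.IA3}$, $\mathrm{H.PRA}$ are the extensions of $\mathrm{H.TQBA}$ by, respectively, (1); (1),(2); (1),(3); (1),(4); (1),(2),(3),(4). **Language of the display calculi.** Three types $\mathsf{D},\mathsf{K}_I,\mathsf{K}_C$. Formulas: $\mathsf{D}$: $A::=p\mid\top\mid\bot\mid\circ_I\alpha\mid\circ_C\xi\mid\neg A\mid A\land A\mid A\lor A$; $\mathsf{K}_I$: $\alpha::=\blacksquare_I A\mid 1_I\mid 0_I\mid\alpha\cap\alpha\mid\alpha\cup\alpha\mid(\sim\alpha)$; $\mathsf{K}_C$: $\xi::=◆_C A\mid 1_C\mid 0_C\mid\xi\sqcap\xi\mid\xi\sqcup\xi\mid(-\xi)$. Structures (structural connectives carry $\hat{\ },\check{\ },\tilde{\ }$): $X::=A\mid\check\bot\mid\hat\top\mid\tilde\circ_C\Pi\mid\tilde\circ_I\Gamma\mid\tilde\neg X\mid X\,\hat\land\,X\mid X\,\check\lor\,X\mid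 X\,\hat\succ\,X\mid X\,\check\to\,X$; $\Gamma::=\alpha\mid\check\blacksquare_I X\mid\hat{◆}_I X\mid\check 0_I\mid\hat 1_I\mid\Gamma\,\hat\cap\,\Gamma\mid\Gamma\,\check\cup\,\Gamma\mid\Gamma\,\hat\succ_I\,\Gamma\mid\Gamma\,\check\to_I\,\Gamma\mid(\tilde\sim\Gamma)$; $\Pi::=\xi\mid\hat{◆}_C X\mid\check\blacksquare_C X\mid\check 0_C\mid\hat 1_C\mid\Pi\,\hat\sqcap\,\Pi\mid\Pi\,\check\sqcup\,\Pi\mid\Pi\,\hat\succ_C\,\Pi\mid\Pi\,\check\to_C\,\Pi\mid(\tilde-\Pi)$. Here $\hat\succ,\hat\succ_I,\hat\succ_C$ are structural co-implications and $\check\to,\check\to_I,\check\to_C$ structural implications. Items in round brackets belong only to $\mathrm{D.TQBA5}$ and its extensions. Sequents relate two structures of the same type. Variables: $X,Y,Z,W$ of type $\mathsf{D}$; $\Gamma,\Delta,\Lambda$ of type $\mathsf{K}_I$; $\Pi,\Sigma,\Omega$ of type $\mathsf{K}_C$. Below "$S\,/\,S'$" means from $S$ infer $S'$, and "$S\,/\!/\,S'$" means the rule can be applied in both directions. **Rules of $\mathrm{D.TQBA}$.** - Identity $p\vdash p$. Cut in each type: $X\vdash A$ and $A\vdash Y$ / $X\vdash Y$; $\Gamma\vdash\alpha$ and $\alpha\vdash\Delta$ / $\Gamma\vdash\Delta$; $\Pi\vdash\xi$ and $\xi\vdash\Sigma$ / $\Pi\vdash\Sigma$. - Pure display rules: $X\,\hat\land\,Y\vdash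 Z$ // $Y\vdash X\,\check\to\,Z$; $X\vdash Y\,\check\lor\,Z$ // $Y\,\hat\succ\,X\vdash Z$; $\tilde\neg X\vdash Y$ // $\tilde\neg Y\vdash X$; $X\vdash\tilde\neg Y$ // $Y\vdash\tilde\neg X$; $\Gamma\,\hat\cap\,\Delta\vdash\Lambda$ // $\Delta\vdash\Gamma\,\check\to_I\,\Lambda$; $\Gamma\vdash\Delta\,\check\cup\,\Lambda$ // $\Delta\,\hat\succ_I\,\Gamma\vdash\Lambda$; $\Pi\,\hat\sqcap\,\Sigma\vdash\Omega$ // $\Sigma\vdash\Pi\,\check\to_C\,\Omega$; $\Pi\vdash\Sigma\,\check\sqcup\,\Omega$ // $\Sigma\,\hat\succ_C\,\Pi\vdash\Omega$. - Multi-type display rules: $\tilde\circ_I\Gamma\vdash Y$ // $\Gamma\vdash\check\blacksquare_I Y$; $Y\vdash\tilde\circ_I\Gamma$ // $\hat{◆}_I Y\vdash\Gamma$; $Y\vdash\tilde\circ_C\Pi$ // $\hat{◆}_C Y\vdash\Pi$; $\tilde\circ_C\Pi\vdash X$ // $\Pi\vdash\check\blacksquare_C X$. - Pure structural rules: in each type, standard weakening, contraction, commutativity and associativity, for the structural conjunction ($\hat\land,\hat\cap,\hat\sqcap$) on the left of $\vdash$ and the structural disjunction ($\check\lor,\check\cup,\check\sqcup$) on the right; $X\vdash Y$ // $\tilde\neg Y\vdash\tilde\neg X$; $X\vdash Y$ // $X\,\hat\land\,\hat\top\vdash Y$; $X\vdash Y$ // $X\vdash Y\,\check\lor\,\check\bot$;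 and likewise for $(\hat\cap,\hat 1_I)$, $(\check\cup,\check 0_I)$, $(\hat\sqcap,\hat 1_C)$, $(\check\sqcup,\check 0_C)$. - Multi-type structural rules: $\hat\top\vdash Y$ // $\tilde\circ_I\hat 1_I\vdash Y$; $\Gamma\vdash\check\blacksquare_I\check\bot$ // $\Gamma\vdash\check 0_I$; $\hat{◆}_C\hat\top\vdash\Pi$ // $\hat 1_C\vdash\Pi$; $X\vdash\check\bot$ // $X\vdash\tilde\circ_C\check 0_C$; $\tilde\circ_I\Gamma\vdash\tilde\circ_I\Delta$ // $\Gamma\vdash\Delta$; $\tilde\circ_C\Pi\vdash\tilde\circ_C\Sigma$ // $\Pi\vdash\Sigma$; $\hat{◆}_C X\vdash\check\blacksquare_C Y$ / $X\vdash Y$; $\hat{◆}_I X\vdash\check\blacksquare_I Y$ / $X\vdash Y$; $X\vdash\tilde\circ_I\check\blacksquare_I\tilde\neg Y$ // $X\vdash\tilde\neg\tilde\circ_C\hat{◆}_C Y$; $X\vdash\tilde\circ_C\check\blacksquare_C\tilde\neg Y$ // $X\vdash\tilde\neg\tilde\circ_I\hat{◆}_I Y$; $\tilde\circ_C\hat{◆}_C\tilde\neg X\vdash Y$ // $\tilde\neg\tilde\circ_I\check\blacksquare_I X\vdash Y$; $\tilde\circ_I\hat{◆}_I\tilde\neg X\vdash Y$ // $\tilde\neg\tilde\circ_C\check\blacksquare_C X\vdash Y$. - Operational rules for pure-type connectives (standard): $\hat\top\vdash\top$; $\hat\top\vdash X$ / $\top\vdash X$; $\bot\vdash\check\bot$;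 $X\vdash\check\bot$ / $X\vdash\bot$; $A\,\hat\land\,B\vdash X$ / $A\land B\vdash X$; $X\vdash A$ and $Y\vdash B$ / $X\,\hat\land\,Y\vdash A\land B$; $A\vdash X$ and $B\vdash Y$ / $A\lor B\vdash X\,\check\lor\,Y$; $X\vdash A\,\check\lor\,B$ / $X\vdash A\lor B$; $\tilde\neg A\vdash X$ / $\neg A\vdash X$; $X\vdash\tilde\neg A$ / $X\vdash\neg A$; and likewise for $1_I,0_I,\cap,\cup$ and $1_C,0_C,\sqcap,\sqcup$. - Operational rules for multi-type connectives: $\Gamma\vdash\check\blacksquare_I A$ / $\Gamma\vdash\blacksquare_I A$; $A\vdash X$ / $\blacksquare_I A\vdash\check\blacksquare_I X$; $\hat{◆}_C A\vdash\Pi$ / $◆_C A\vdash\Pi$; $X\vdash A$ / $\hat{◆}_C X\vdash ◆_C A$; $X\vdash\tilde\circ_I\alpha$ / $X\vdash\circ_I\alpha$; $\tilde\circ_I\alpha\vdash X$ / $\circ_I\alpha\vdash X$; $X\vdash\tilde\circ_C\xi$ / $X\vdash\circ_C\xi$; $\tilde\circ_C\xi\vdash X$ / $\circ_C\xi\vdash X$. **$\mathrm{D.TQBA5}$** adds: $\tilde\sim\Gamma\vdash\Delta$ // $\tilde\sim\Delta\vdash\Gamma$; $\Gamma\vdash\tilde\sim\Delta$ // $\Delta\vdash\tilde\sim\Gamma$; $\tilde-\Pi\vdash\Sigma$ // $\tilde-\Sigma\vdash\Pi$; $\Pi\vdash\tilde-\Sigma$ // $\Sigma\vdash\tilde-\Pi$;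 $\Gamma\vdash\Delta$ // $\tilde\sim\Delta\vdash\tilde\sim\Gamma$; $\Pi\vdash\Sigma$ // $\tilde-\Sigma\vdash\tilde-\Pi$; $X\vdash\tilde\circ_I\check\blacksquare_I Y$ // $X\vdash\tilde\circ_C\check\blacksquare_C Y$; $X\vdash\tilde\circ_I\tilde\sim\Gamma$ / $X\vdash\tilde\neg\tilde\circ_I\Gamma$; $X\vdash\tilde\circ_C\tilde-\Pi$ / $X\vdash\tilde\neg\tilde\circ_C\Pi$; and operational rules $\Gamma\vdash\tilde\sim\alpha$ / $\Gamma\vdash\sim\alpha$; $\tilde\sim\alpha\vdash\Gamma$ / $\sim\alpha\vdash\Gamma$; $\Pi\vdash\tilde-\xi$ / $\Pi\vdash-\xi$; $\tilde-\xi\vdash\Pi$ / $-\xi\vdash\Pi$. **Extensions of $\mathrm{D.TQBA5}$.** $\mathrm{D.IA1}$ adds (cgri): $\Gamma\,\hat\cap\,\Delta\vdash\Lambda$ / $\Delta\vdash\tilde\sim\Gamma\,\check\cup\,\Lambda$ and $\Pi\,\hat\sqcap\,\Sigma\vdash\Omega$ / $\Sigma\vdash\tilde-\Pi\,\check\sqcup\,\Omega$. $\mathrm{D.IA2}$ adds $\Gamma\vdash\check\blacksquare_I(X\,\check\lor\,Y)$ / $\Gamma\vdash\check\blacksquare_I X\,\check\cup\,\check\blacksquare_I Y$ and $\hat{◆}_C(X\,\hat\land\,Y)\vdash\Pi$ / $\hat{◆}_C X\,\hat\sqcap\,\hat{◆}_C Y\vdash\Pi$. $\mathrm{D.IA3}$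 adds (ia3): $X\vdash Y$ and $W\vdash Z$ / $X\,\hat\land\,\tilde\circ_C\hat{◆}_C W\vdash\tilde\circ_I\check\blacksquare_I Y\,\check\lor\,Z$. $\mathrm{D.PRA}$ adds all the rules of $\mathrm{D.IA1}$, $\mathrm{D.IA2}$ and $\mathrm{D.IA3}$. **Translation.** $(\cdot)^\tau$ maps $\mathcal{L}$-formulas to $\mathsf{D}$-formulas: $p^\tau=p$, $\top^\tau=\top$, $\bot^\tau=\bot$, $(A\land B)^\tau=A^\tau\land B^\tau$, $(A\lor B)^\tau=A^\tau\lor B^\tau$, $(\neg A)^\tau=\neg A^\tau$, $(IA)^\tau=\circ_I\blacksquare_I A^\tau$, $(CA)^\tau=\circ_C ◆_C A^\tau$. *)

theory Defs
  imports Main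
begin

datatype tqba_logic = TQBA | TQBA5 | IA1 | IA2 | IA3 | PRA

datatype form =
    PVar nat | PTop | PBot | PNeg form | PI form | PC form | PAnd form form | POr form form

inductive H_derivable :: "tqba_logic \<Rightarrow> form \<Rightarrow> form \<Rightarrow> bool" for L where
  ax_refl: "H_derivable L A A" |
  ax_bot: "H_derivable L PBot A" |
  ax_top: "H_derivable L A PTop" |
  ax_and1: "H_derivable L (PAnd A B) A" |
  ax_and2: "H_derivable L (PAnd A B) B" |
  ax_or1: "H_derivable L A (POr A B)" |
  ax_or2: "H_derivable L B (POr A B)" |
  ax_dist: "H_derivable L (PAnd A (POr B E)) (POr (PAnd A B) (PAnd A E))" |
  ax_dn1: "H_derivable L A (PNeg (PNeg A))" |
  ax_dn2: "H_derivable L (PNeg (PNeg A)) A" |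
  rl_trans: "H_derivable L A B \<Longrightarrow> H_derivable L B E \<Longrightarrow> H_derivable L A E" |
  rl_and: "H_derivable L A B \<Longrightarrow> H_derivable L A E \<Longrightarrow> H_derivable L A (PAnd B E)" |
  rl_or: "H_derivable L A E \<Longrightarrow> H_derivable L B E \<Longrightarrow> H_derivable L (POr A B) E" |
  rl_neg: "H_derivable L A B \<Longrightarrow> H_derivable L (PNeg B) (PNeg A)" |
  ax_T: "H_derivable L (PI A) A" |
  ax_4: "H_derivable L (PI A) (PI (PI A))" |
  ax_I_and1: "H_derivable L (PI (PAnd A B)) (PAnd (PI A) (PI B))" |
  ax_I_and2: "H_derivable L (PAnd (PI A) (PI B)) (PI (PAnd A B))" |
  ax_I_top: "H_derivable L PTop (PI PTop)" |
  ax_C1: "H_derivable L (PC A) (PNeg (PI (PNeg A)))" |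
  ax_C2: "H_derivable L (PNeg (PI (PNeg A))) (PC A)" |
  ax_I1: "H_derivable L (PNeg (PC (PNeg A))) (PI A)" |
  ax_I2: "H_derivable L (PI A) (PNeg (PC (PNeg A)))" |
  rl_I_mono: "H_derivable L A B \<Longrightarrow> H_derivable L (PI A) (PI B)" |
  ax_5: "L \<noteq> TQBA \<Longrightarrow> H_derivable L (PC (PI A)) (PI A)" |
  ax_em: "L \<in> {IA1, PRA} \<Longrightarrow> H_derivable L PTop (POr (PI A) (PNeg (PI A)))" |
  ax_I_or: "L \<in> {IA2, PRA} \<Longrightarrow> H_derivable L (PI (POr A B)) (POr (PI A) (PI B))" |
  rl_IC: "L \<in> {IA3, PRA} \<Longrightarrow> H_derivable L (PI A) (PI B) \<Longrightarrow> H_derivable L (PC A) (PC B)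
      \<Longrightarrow> H_derivable L A B"

datatype dform =
    Var nat | Top | Bot | Circ\<^sub>I iform | Circ\<^sub>C cform | Neg dform
  | And dform dform | Or dform dform
and iform =
    Box\<^sub>I dform | One\<^sub>I | Zero\<^sub>I | Cap iform iform | Cup iform iform | Sim iform
and cform =
    Dia\<^sub>C dform | One\<^sub>C | Zero\<^sub>C | Sqcap cform cform | Sqcup cform cform | Minus cform

text \<open>The symbols \<open>\<succ>\<close> and \<open>\<rightarrow>\<close> are structural co-implication and implication. The other structural
  connectives carry the prefix \<open>s\<close> or are infix symbols subscripted by the type (formula-level
  binary connectives are prefix constructors); \<open>fmD\<close>, \<open>fmI\<close>, \<open>fmC\<close> regard a formula as a structure.\<close>

datatype dstr =
    fmD dform | sBot | sTop | sCirc\<^sub>C cstr | sCirc\<^sub>I istr | sNeg dstr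
  | sAnd dstr dstr (infixl "\<and>\<^sub>D" 65) | sOr dstr dstr (infixl "\<or>\<^sub>D" 60)
  | sCoimp\<^sub>D dstr dstr (infixr "\<succ>\<^sub>D" 55) | sImp\<^sub>D dstr dstr (infixr "\<rightarrow>\<^sub>D" 55)
and istr =
    fmI iform | sBox\<^sub>I dstr | sDia\<^sub>I dstr | sZero\<^sub>I | sOne\<^sub>I
  | sCap istr istr (infixl "\<inter>\<^sub>I" 65) | sCup istr istr (infixl "\<union>\<^sub>I" 60)
  | sCoimp\<^sub>I istr istr (infixr "\<succ>\<^sub>I" 55) | sImp\<^sub>I istr istr (infixr "\<rightarrow>\<^sub>I" 55)
  | sSim istr
and cstr =
    fmC cform | sDia\<^sub>C dstr | sBox\<^sub>C dstr | sZero\<^sub>C | sOne\<^sub>C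
  | sSqcap cstr cstr (infixl "\<sqinter>\<^sub>C" 65) | sSqcup cstr cstr (infixl "\<squnion>\<^sub>C" 60)
  | sCoimp\<^sub>C cstr cstr (infixr "\<succ>\<^sub>C" 55) | sImp\<^sub>C cstr cstr (infixr "\<rightarrow>\<^sub>C" 55)
  | sMinus cstr

datatype seqt =
    SeqD dstr dstr (infix "\<turnstile>\<^sub>D" 50)
  | SeqI istr istr (infix "\<turnstile>\<^sub>I" 50)
  | SeqC cstr cstr (infix "\<turnstile>\<^sub>C" 50)

text \<open>The connectives \<open>Sim\<close>, \<open>Minus\<close>, \<open>sSim\<close>, \<open>sMinus\<close> do not belong to the language of the calculus
  for \<open>TQBA\<close>. The predicates below say that they do not occur.\<close>

primrec kneg_free_dform :: "dform \<Rightarrow> bool" and kneg_free_iform :: "iform \<Rightarrow> bool"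
    and kneg_free_cform :: "cform \<Rightarrow> bool" where
  "kneg_free_dform (Var p) = True" |
  "kneg_free_dform Top = True" |
  "kneg_free_dform Bot = True" |
  "kneg_free_dform (Circ\<^sub>I \<alpha>) = kneg_free_iform \<alpha>" |
  "kneg_free_dform (Circ\<^sub>C \<xi>) = kneg_free_cform \<xi>" |
  "kneg_free_dform (Neg A) = kneg_free_dform A" |
  "kneg_free_dform (And A B) = (kneg_free_dform A \<and> kneg_free_dform B)" |
  "kneg_free_dform (Or A B) = (kneg_free_dform A \<and> kneg_free_dform B)" |
  "kneg_free_iform (Box\<^sub>I A) = kneg_free_dform A" |
  "kneg_free_iform One\<^sub>I = True" |
  "kneg_free_iform Zero\<^sub>I = True" |
  "kneg_free_iform (Cap \<alpha> \<beta>) = (kneg_free_iform \<alpha> \<and> kneg_free_iform \<beta>)" |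
  "kneg_free_iform (Cup \<alpha> \<beta>) = (kneg_free_iform \<alpha> \<and> kneg_free_iform \<beta>)" |
  "kneg_free_iform (Sim \<alpha>) = False" |
  "kneg_free_cform (Dia\<^sub>C A) = kneg_free_dform A" |
  "kneg_free_cform One\<^sub>C = True" |
  "kneg_free_cform Zero\<^sub>C = True" |
  "kneg_free_cform (Sqcap \<xi> \<chi>) = (kneg_free_cform \<xi> \<and> kneg_free_cform \<chi>)" |
  "kneg_free_cform (Sqcup \<xi> \<chi>) = (kneg_free_cform \<xi> \<and> kneg_free_cform \<chi>)" |
  "kneg_free_cform (Minus \<xi>) = False"

primrec kneg_free_dstr :: "dstr \<Rightarrow> bool" and kneg_free_istr :: "istr \<Rightarrow> bool"
    and kneg_free_cstr :: "cstr \<Rightarrow> bool" where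
  "kneg_free_dstr (fmD A) = kneg_free_dform A" |
  "kneg_free_dstr sBot = True" |
  "kneg_free_dstr sTop = True" |
  "kneg_free_dstr (sCirc\<^sub>C \<Pi>) = kneg_free_cstr \<Pi>" |
  "kneg_free_dstr (sCirc\<^sub>I \<Gamma>) = kneg_free_istr \<Gamma>" |
  "kneg_free_dstr (sNeg X) = kneg_free_dstr X" |
  "kneg_free_dstr (X \<and>\<^sub>D Y) = (kneg_free_dstr X \<and> kneg_free_dstr Y)" |
  "kneg_free_dstr (X \<or>\<^sub>D Y) = (kneg_free_dstr X \<and> kneg_free_dstr Y)" |
  "kneg_free_dstr (X \<succ>\<^sub>D Y) = (kneg_free_dstr X \<and> kneg_free_dstr Y)" |
  "kneg_free_dstr (X \<rightarrow>\<^sub>D Y) = (kneg_free_dstr X \<and> kneg_free_dstr Y)" |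
  "kneg_free_istr (fmI \<alpha>) = kneg_free_iform \<alpha>" |
  "kneg_free_istr (sBox\<^sub>I X) = kneg_free_dstr X" |
  "kneg_free_istr (sDia\<^sub>I X) = kneg_free_dstr X" |
  "kneg_free_istr sZero\<^sub>I = True" |
  "kneg_free_istr sOne\<^sub>I = True" |
  "kneg_free_istr (\<Gamma> \<inter>\<^sub>I \<Delta>) = (kneg_free_istr \<Gamma> \<and> kneg_free_istr \<Delta>)" |
  "kneg_free_istr (\<Gamma> \<union>\<^sub>I \<Delta>) = (kneg_free_istr \<Gamma> \<and> kneg_free_istr \<Delta>)" |
  "kneg_free_istr (\<Gamma> \<succ>\<^sub>I \<Delta>) = (kneg_free_istr \<Gamma> \<and> kneg_free_istr \<Delta>)" |
  "kneg_free_istr (\<Gamma> \<rightarrow>\<^sub>I \<Delta>) = (kneg_free_istr \<Gamma> \<and> kneg_free_istr \<Delta>)" |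
  "kneg_free_istr (sSim \<Gamma>) = False" |
  "kneg_free_cstr (fmC \<xi>) = kneg_free_cform \<xi>" |
  "kneg_free_cstr (sDia\<^sub>C X) = kneg_free_dstr X" |
  "kneg_free_cstr (sBox\<^sub>C X) = kneg_free_dstr X" |
  "kneg_free_cstr sZero\<^sub>C = True" |
  "kneg_free_cstr sOne\<^sub>C = True" |
  "kneg_free_cstr (\<Pi> \<sqinter>\<^sub>C \<Sigma>) = (kneg_free_cstr \<Pi> \<and> kneg_free_cstr \<Sigma>)" |
  "kneg_free_cstr (\<Pi> \<squnion>\<^sub>C \<Sigma>) = (kneg_free_cstr \<Pi> \<and> kneg_free_cstr \<Sigma>)" |
  "kneg_free_cstr (\<Pi> \<succ>\<^sub>C \<Sigma>) = (kneg_free_cstr \<Pi> \<and> kneg_free_cstr \<Sigma>)" |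
  "kneg_free_cstr (\<Pi> \<rightarrow>\<^sub>C \<Sigma>) = (kneg_free_cstr \<Pi> \<and> kneg_free_cstr \<Sigma>)" |
  "kneg_free_cstr (sMinus \<Pi>) = False"

primrec kneg_free_seqt :: "seqt \<Rightarrow> bool" where
  "kneg_free_seqt (X \<turnstile>\<^sub>D Y) = (kneg_free_dstr X \<and> kneg_free_dstr Y)" |
  "kneg_free_seqt (\<Gamma> \<turnstile>\<^sub>I \<Delta>) = (kneg_free_istr \<Gamma> \<and> kneg_free_istr \<Delta>)" |
  "kneg_free_seqt (\<Pi> \<turnstile>\<^sub>C \<Sigma>) = (kneg_free_cstr \<Pi> \<and> kneg_free_cstr \<Sigma>)"

definition in_language :: "tqba_logic \<Rightarrow> seqt \<Rightarrow> bool" where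
  "in_language L S \<longleftrightarrow> (L = TQBA \<longrightarrow> kneg_free_seqt S)"

text \<open>\<open>two_way L S S'\<close>: an instance of a rule that may be applied in both directions.\<close>

inductive two_way :: "tqba_logic \<Rightarrow> seqt \<Rightarrow> seqt \<Rightarrow> bool" for L where
  res_conj_D: "two_way L (X \<and>\<^sub>D Y \<turnstile>\<^sub>D Z) (Y \<turnstile>\<^sub>D X \<rightarrow>\<^sub>D Z)" |
  res_disj_D: "two_way L (X \<turnstile>\<^sub>D Y \<or>\<^sub>D Z) (Y \<succ>\<^sub>D X \<turnstile>\<^sub>D Z)" |
  res_conj_I: "two_way L (\<Gamma> \<inter>\<^sub>I \<Delta> \<turnstile>\<^sub>I \<Lambda>) (\<Delta> \<turnstile>\<^sub>I \<Gamma> \<rightarrow>\<^sub>I \<Lambda>)" |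
  res_disj_I: "two_way L (\<Gamma> \<turnstile>\<^sub>I \<Delta> \<union>\<^sub>I \<Lambda>) (\<Delta> \<succ>\<^sub>I \<Gamma> \<turnstile>\<^sub>I \<Lambda>)" |
  res_conj_C: "two_way L (\<Pi> \<sqinter>\<^sub>C \<Sigma> \<turnstile>\<^sub>C \<Omega>) (\<Sigma> \<turnstile>\<^sub>C \<Pi> \<rightarrow>\<^sub>C \<Omega>)" |
  res_disj_C: "two_way L (\<Pi> \<turnstile>\<^sub>C \<Sigma> \<squnion>\<^sub>C \<Omega>) (\<Sigma> \<succ>\<^sub>C \<Pi> \<turnstile>\<^sub>C \<Omega>)" |
  assoc_left_D: "two_way L ((X \<and>\<^sub>D Y) \<and>\<^sub>D Z \<turnstile>\<^sub>D W) (X \<and>\<^sub>D (Y \<and>\<^sub>D Z) \<turnstile>\<^sub>D W)" |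
  assoc_right_D: "two_way L (X \<turnstile>\<^sub>D (Y \<or>\<^sub>D Z) \<or>\<^sub>D W) (X \<turnstile>\<^sub>D Y \<or>\<^sub>D (Z \<or>\<^sub>D W))" |
  unit_left_D: "two_way L (X \<turnstile>\<^sub>D Y) (X \<and>\<^sub>D sTop \<turnstile>\<^sub>D Y)" |
  unit_right_D: "two_way L (X \<turnstile>\<^sub>D Y) (X \<turnstile>\<^sub>D Y \<or>\<^sub>D sBot)" |
  assoc_left_I: "two_way L ((\<Gamma> \<inter>\<^sub>I \<Delta>) \<inter>\<^sub>I \<Lambda> \<turnstile>\<^sub>I \<Theta>) (\<Gamma> \<inter>\<^sub>I (\<Delta> \<inter>\<^sub>I \<Lambda>) \<turnstile>\<^sub>I \<Theta>)" |
  assoc_right_I: "two_way L (\<Gamma> \<turnstile>\<^sub>I (\<Delta> \<union>\<^sub>I \<Lambda>) \<union>\<^sub>I \<Theta>) (\<Gamma> \<turnstile>\<^sub>I \<Delta> \<union>\<^sub>I (\<Lambda> \<union>\<^sub>I \<Theta>))" |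
  unit_left_I: "two_way L (\<Gamma> \<turnstile>\<^sub>I \<Delta>) (\<Gamma> \<inter>\<^sub>I sOne\<^sub>I \<turnstile>\<^sub>I \<Delta>)" |
  unit_right_I: "two_way L (\<Gamma> \<turnstile>\<^sub>I \<Delta>) (\<Gamma> \<turnstile>\<^sub>I \<Delta> \<union>\<^sub>I sZero\<^sub>I)" |
  assoc_left_C: "two_way L ((\<Pi> \<sqinter>\<^sub>C \<Sigma>) \<sqinter>\<^sub>C \<Omega> \<turnstile>\<^sub>C \<Xi>) (\<Pi> \<sqinter>\<^sub>C (\<Sigma> \<sqinter>\<^sub>C \<Omega>) \<turnstile>\<^sub>C \<Xi>)" |
  assoc_right_C: "two_way L (\<Pi> \<turnstile>\<^sub>C (\<Sigma> \<squnion>\<^sub>C \<Omega>) \<squnion>\<^sub>C \<Xi>) (\<Pi> \<turnstile>\<^sub>C \<Sigma> \<squnion>\<^sub>C (\<Omega> \<squnion>\<^sub>C \<Xi>))" |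
  unit_left_C: "two_way L (\<Pi> \<turnstile>\<^sub>C \<Sigma>) (\<Pi> \<sqinter>\<^sub>C sOne\<^sub>C \<turnstile>\<^sub>C \<Sigma>)" |
  unit_right_C: "two_way L (\<Pi> \<turnstile>\<^sub>C \<Sigma>) (\<Pi> \<turnstile>\<^sub>C \<Sigma> \<squnion>\<^sub>C sZero\<^sub>C)" |
  gal_left_D: "two_way L (sNeg X \<turnstile>\<^sub>D Y) (sNeg Y \<turnstile>\<^sub>D X)" |
  gal_right_D: "two_way L (X \<turnstile>\<^sub>D sNeg Y) (Y \<turnstile>\<^sub>D sNeg X)" |
  contra_D: "two_way L (X \<turnstile>\<^sub>D Y) (sNeg Y \<turnstile>\<^sub>D sNeg X)" |
  adj_circ_box_I: "two_way L (sCirc\<^sub>I \<Gamma> \<turnstile>\<^sub>D Y) (\<Gamma> \<turnstile>\<^sub>I sBox\<^sub>I Y)" |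
  adj_dia_circ_I: "two_way L (Y \<turnstile>\<^sub>D sCirc\<^sub>I \<Gamma>) (sDia\<^sub>I Y \<turnstile>\<^sub>I \<Gamma>)" |
  adj_dia_circ_C: "two_way L (Y \<turnstile>\<^sub>D sCirc\<^sub>C \<Pi>) (sDia\<^sub>C Y \<turnstile>\<^sub>C \<Pi>)" |
  adj_circ_box_C: "two_way L (sCirc\<^sub>C \<Pi> \<turnstile>\<^sub>D X) (\<Pi> \<turnstile>\<^sub>C sBox\<^sub>C X)" |
  circ_one_I: "two_way L (sTop \<turnstile>\<^sub>D Y) (sCirc\<^sub>I sOne\<^sub>I \<turnstile>\<^sub>D Y)" |
  box_bot_I: "two_way L (\<Gamma> \<turnstile>\<^sub>I sBox\<^sub>I sBot) (\<Gamma> \<turnstile>\<^sub>I sZero\<^sub>I)" |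
  dia_top_C: "two_way L (sDia\<^sub>C sTop \<turnstile>\<^sub>C \<Pi>) (sOne\<^sub>C \<turnstile>\<^sub>C \<Pi>)" |
  circ_zero_C: "two_way L (X \<turnstile>\<^sub>D sBot) (X \<turnstile>\<^sub>D sCirc\<^sub>C sZero\<^sub>C)" |
  circ_emb_I: "two_way L (sCirc\<^sub>I \<Gamma> \<turnstile>\<^sub>D sCirc\<^sub>I \<Delta>) (\<Gamma> \<turnstile>\<^sub>I \<Delta>)" |
  circ_emb_C: "two_way L (sCirc\<^sub>C \<Pi> \<turnstile>\<^sub>D sCirc\<^sub>C \<Sigma>) (\<Pi> \<turnstile>\<^sub>C \<Sigma>)" |
  neg_dia_C: "two_way L (X \<turnstile>\<^sub>D sCirc\<^sub>I (sBox\<^sub>I (sNeg Y))) (X \<turnstile>\<^sub>D sNeg (sCirc\<^sub>C (sDia\<^sub>C Y)))" |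
  neg_dia_I: "two_way L (X \<turnstile>\<^sub>D sCirc\<^sub>C (sBox\<^sub>C (sNeg Y))) (X \<turnstile>\<^sub>D sNeg (sCirc\<^sub>I (sDia\<^sub>I Y)))" |
  neg_box_I: "two_way L (sCirc\<^sub>C (sDia\<^sub>C (sNeg X)) \<turnstile>\<^sub>D Y) (sNeg (sCirc\<^sub>I (sBox\<^sub>I X)) \<turnstile>\<^sub>D Y)" |
  neg_box_C: "two_way L (sCirc\<^sub>I (sDia\<^sub>I (sNeg X)) \<turnstile>\<^sub>D Y) (sNeg (sCirc\<^sub>C (sBox\<^sub>C X)) \<turnstile>\<^sub>D Y)" |
  gal_left_I: "L \<noteq> TQBA \<Longrightarrow> two_way L (sSim \<Gamma> \<turnstile>\<^sub>I \<Delta>) (sSim \<Delta> \<turnstile>\<^sub>I \<Gamma>)" |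
  gal_right_I: "L \<noteq> TQBA \<Longrightarrow> two_way L (\<Gamma> \<turnstile>\<^sub>I sSim \<Delta>) (\<Delta> \<turnstile>\<^sub>I sSim \<Gamma>)" |
  contra_I: "L \<noteq> TQBA \<Longrightarrow> two_way L (\<Gamma> \<turnstile>\<^sub>I \<Delta>) (sSim \<Delta> \<turnstile>\<^sub>I sSim \<Gamma>)" |
  gal_left_C: "L \<noteq> TQBA \<Longrightarrow> two_way L (sMinus \<Pi> \<turnstile>\<^sub>C \<Sigma>) (sMinus \<Sigma> \<turnstile>\<^sub>C \<Pi>)" |
  gal_right_C: "L \<noteq> TQBA \<Longrightarrow> two_way L (\<Pi> \<turnstile>\<^sub>C sMinus \<Sigma>) (\<Sigma> \<turnstile>\<^sub>C sMinus \<Pi>)" |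
  contra_C: "L \<noteq> TQBA \<Longrightarrow> two_way L (\<Pi> \<turnstile>\<^sub>C \<Sigma>) (sMinus \<Sigma> \<turnstile>\<^sub>C sMinus \<Pi>)" |
  box_I_box_C: "L \<noteq> TQBA \<Longrightarrow> two_way L (X \<turnstile>\<^sub>D sCirc\<^sub>I (sBox\<^sub>I Y)) (X \<turnstile>\<^sub>D sCirc\<^sub>C (sBox\<^sub>C Y))"

text \<open>\<open>D_rule L Ss S\<close>: an instance of an inference rule with premises \<open>Ss\<close> and conclusion \<open>S\<close>.\<close>

inductive D_rule :: "tqba_logic \<Rightarrow> seqt list \<Rightarrow> seqt \<Rightarrow> bool" for L where
  down: "two_way L S S' \<Longrightarrow> D_rule L [S] S'" |
  up: "two_way L S S' \<Longrightarrow> D_rule L [S'] S" |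
  identity: "D_rule L [] (fmD (Var p) \<turnstile>\<^sub>D fmD (Var p))" |
  cut_D: "D_rule L [X \<turnstile>\<^sub>D fmD A, fmD A \<turnstile>\<^sub>D Y] (X \<turnstile>\<^sub>D Y)" |
  cut_I: "D_rule L [\<Gamma> \<turnstile>\<^sub>I fmI \<alpha>, fmI \<alpha> \<turnstile>\<^sub>I \<Delta>] (\<Gamma> \<turnstile>\<^sub>I \<Delta>)" |
  cut_C: "D_rule L [\<Pi> \<turnstile>\<^sub>C fmC \<xi>, fmC \<xi> \<turnstile>\<^sub>C \<Sigma>] (\<Pi> \<turnstile>\<^sub>C \<Sigma>)" |
  weak_left_D: "D_rule L [X \<turnstile>\<^sub>D Y] (X \<and>\<^sub>D Z \<turnstile>\<^sub>D Y)" |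
  weak_right_D: "D_rule L [X \<turnstile>\<^sub>D Y] (X \<turnstile>\<^sub>D Y \<or>\<^sub>D Z)" |
  contr_left_D: "D_rule L [X \<and>\<^sub>D X \<turnstile>\<^sub>D Y] (X \<turnstile>\<^sub>D Y)" |
  contr_right_D: "D_rule L [X \<turnstile>\<^sub>D Y \<or>\<^sub>D Y] (X \<turnstile>\<^sub>D Y)" |
  comm_left_D: "D_rule L [X \<and>\<^sub>D Y \<turnstile>\<^sub>D Z] (Y \<and>\<^sub>D X \<turnstile>\<^sub>D Z)" |
  comm_right_D: "D_rule L [X \<turnstile>\<^sub>D Y \<or>\<^sub>D Z] (X \<turnstile>\<^sub>D Z \<or>\<^sub>D Y)" |
  weak_left_I: "D_rule L [\<Gamma> \<turnstile>\<^sub>I \<Delta>] (\<Gamma> \<inter>\<^sub>I \<Lambda> \<turnstile>\<^sub>I \<Delta>)" |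
  weak_right_I: "D_rule L [\<Gamma> \<turnstile>\<^sub>I \<Delta>] (\<Gamma> \<turnstile>\<^sub>I \<Delta> \<union>\<^sub>I \<Lambda>)" |
  contr_left_I: "D_rule L [\<Gamma> \<inter>\<^sub>I \<Gamma> \<turnstile>\<^sub>I \<Delta>] (\<Gamma> \<turnstile>\<^sub>I \<Delta>)" |
  contr_right_I: "D_rule L [\<Gamma> \<turnstile>\<^sub>I \<Delta> \<union>\<^sub>I \<Delta>] (\<Gamma> \<turnstile>\<^sub>I \<Delta>)" |
  comm_left_I: "D_rule L [\<Gamma> \<inter>\<^sub>I \<Delta> \<turnstile>\<^sub>I \<Lambda>] (\<Delta> \<inter>\<^sub>I \<Gamma> \<turnstile>\<^sub>I \<Lambda>)" |
  comm_right_I: "D_rule L [\<Gamma> \<turnstile>\<^sub>I \<Delta> \<union>\<^sub>I \<Lambda>] (\<Gamma> \<turnstile>\<^sub>I \<Lambda> \<union>\<^sub>I \<Delta>)" |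
  weak_left_C: "D_rule L [\<Pi> \<turnstile>\<^sub>C \<Sigma>] (\<Pi> \<sqinter>\<^sub>C \<Omega> \<turnstile>\<^sub>C \<Sigma>)" |
  weak_right_C: "D_rule L [\<Pi> \<turnstile>\<^sub>C \<Sigma>] (\<Pi> \<turnstile>\<^sub>C \<Sigma> \<squnion>\<^sub>C \<Omega>)" |
  contr_left_C: "D_rule L [\<Pi> \<sqinter>\<^sub>C \<Pi> \<turnstile>\<^sub>C \<Sigma>] (\<Pi> \<turnstile>\<^sub>C \<Sigma>)" |
  contr_right_C: "D_rule L [\<Pi> \<turnstile>\<^sub>C \<Sigma> \<squnion>\<^sub>C \<Sigma>] (\<Pi> \<turnstile>\<^sub>C \<Sigma>)" |
  comm_left_C: "D_rule L [\<Pi> \<sqinter>\<^sub>C \<Sigma> \<turnstile>\<^sub>C \<Omega>] (\<Sigma> \<sqinter>\<^sub>C \<Pi> \<turnstile>\<^sub>C \<Omega>)" |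
  comm_right_C: "D_rule L [\<Pi> \<turnstile>\<^sub>C \<Sigma> \<squnion>\<^sub>C \<Omega>] (\<Pi> \<turnstile>\<^sub>C \<Omega> \<squnion>\<^sub>C \<Sigma>)" |
  top_right_D: "D_rule L [] (sTop \<turnstile>\<^sub>D fmD Top)" |
  top_left_D: "D_rule L [sTop \<turnstile>\<^sub>D X] (fmD Top \<turnstile>\<^sub>D X)" |
  bot_left_D: "D_rule L [] (fmD Bot \<turnstile>\<^sub>D sBot)" |
  bot_right_D: "D_rule L [X \<turnstile>\<^sub>D sBot] (X \<turnstile>\<^sub>D fmD Bot)" |
  conj_left_D: "D_rule L [fmD A \<and>\<^sub>D fmD B \<turnstile>\<^sub>D X] (fmD (And A B) \<turnstile>\<^sub>D X)" |
  conj_right_D: "D_rule L [X \<turnstile>\<^sub>D fmD A, Y \<turnstile>\<^sub>D fmD B] (X \<and>\<^sub>D Y \<turnstile>\<^sub>D fmD (And A B))" |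
  disj_left_D: "D_rule L [fmD A \<turnstile>\<^sub>D X, fmD B \<turnstile>\<^sub>D Y] (fmD (Or A B) \<turnstile>\<^sub>D X \<or>\<^sub>D Y)" |
  disj_right_D: "D_rule L [X \<turnstile>\<^sub>D fmD A \<or>\<^sub>D fmD B] (X \<turnstile>\<^sub>D fmD (Or A B))" |
  neg_left_D: "D_rule L [sNeg (fmD A) \<turnstile>\<^sub>D X] (fmD (Neg A) \<turnstile>\<^sub>D X)" |
  neg_right_D: "D_rule L [X \<turnstile>\<^sub>D sNeg (fmD A)] (X \<turnstile>\<^sub>D fmD (Neg A))" |
  top_right_I: "D_rule L [] (sOne\<^sub>I \<turnstile>\<^sub>I fmI One\<^sub>I)" |
  top_left_I: "D_rule L [sOne\<^sub>I \<turnstile>\<^sub>I \<Gamma>] (fmI One\<^sub>I \<turnstile>\<^sub>I \<Gamma>)" |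
  bot_left_I: "D_rule L [] (fmI Zero\<^sub>I \<turnstile>\<^sub>I sZero\<^sub>I)" |
  bot_right_I: "D_rule L [\<Gamma> \<turnstile>\<^sub>I sZero\<^sub>I] (\<Gamma> \<turnstile>\<^sub>I fmI Zero\<^sub>I)" |
  conj_left_I: "D_rule L [fmI \<alpha> \<inter>\<^sub>I fmI \<beta> \<turnstile>\<^sub>I \<Gamma>] (fmI (Cap \<alpha> \<beta>) \<turnstile>\<^sub>I \<Gamma>)" |
  conj_right_I: "D_rule L [\<Gamma> \<turnstile>\<^sub>I fmI \<alpha>, \<Delta> \<turnstile>\<^sub>I fmI \<beta>] (\<Gamma> \<inter>\<^sub>I \<Delta> \<turnstile>\<^sub>I fmI (Cap \<alpha> \<beta>))" |
  disj_left_I: "D_rule L [fmI \<alpha> \<turnstile>\<^sub>I \<Gamma>, fmI \<beta> \<turnstile>\<^sub>I \<Delta>] (fmI (Cup \<alpha> \<beta>) \<turnstile>\<^sub>I \<Gamma> \<union>\<^sub>I \<Delta>)" |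
  disj_right_I: "D_rule L [\<Gamma> \<turnstile>\<^sub>I fmI \<alpha> \<union>\<^sub>I fmI \<beta>] (\<Gamma> \<turnstile>\<^sub>I fmI (Cup \<alpha> \<beta>))" |
  top_right_C: "D_rule L [] (sOne\<^sub>C \<turnstile>\<^sub>C fmC One\<^sub>C)" |
  top_left_C: "D_rule L [sOne\<^sub>C \<turnstile>\<^sub>C \<Pi>] (fmC One\<^sub>C \<turnstile>\<^sub>C \<Pi>)" |
  bot_left_C: "D_rule L [] (fmC Zero\<^sub>C \<turnstile>\<^sub>C sZero\<^sub>C)" |
  bot_right_C: "D_rule L [\<Pi> \<turnstile>\<^sub>C sZero\<^sub>C] (\<Pi> \<turnstile>\<^sub>C fmC Zero\<^sub>C)" |
  conj_left_C: "D_rule L [fmC \<xi> \<sqinter>\<^sub>C fmC \<chi> \<turnstile>\<^sub>C \<Pi>] (fmC (Sqcap \<xi> \<chi>) \<turnstile>\<^sub>C \<Pi>)" |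
  conj_right_C: "D_rule L [\<Pi> \<turnstile>\<^sub>C fmC \<xi>, \<Sigma> \<turnstile>\<^sub>C fmC \<chi>] (\<Pi> \<sqinter>\<^sub>C \<Sigma> \<turnstile>\<^sub>C fmC (Sqcap \<xi> \<chi>))" |
  disj_left_C: "D_rule L [fmC \<xi> \<turnstile>\<^sub>C \<Pi>, fmC \<chi> \<turnstile>\<^sub>C \<Sigma>] (fmC (Sqcup \<xi> \<chi>) \<turnstile>\<^sub>C \<Pi> \<squnion>\<^sub>C \<Sigma>)" |
  disj_right_C: "D_rule L [\<Pi> \<turnstile>\<^sub>C fmC \<xi> \<squnion>\<^sub>C fmC \<chi>] (\<Pi> \<turnstile>\<^sub>C fmC (Sqcup \<xi> \<chi>))" |
  dia_box_C: "D_rule L [sDia\<^sub>C X \<turnstile>\<^sub>C sBox\<^sub>C Y] (X \<turnstile>\<^sub>D Y)" |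
  dia_box_I: "D_rule L [sDia\<^sub>I X \<turnstile>\<^sub>I sBox\<^sub>I Y] (X \<turnstile>\<^sub>D Y)" |
  box_right_I: "D_rule L [\<Gamma> \<turnstile>\<^sub>I sBox\<^sub>I (fmD A)] (\<Gamma> \<turnstile>\<^sub>I fmI (Box\<^sub>I A))" |
  box_left_I: "D_rule L [fmD A \<turnstile>\<^sub>D X] (fmI (Box\<^sub>I A) \<turnstile>\<^sub>I sBox\<^sub>I X)" |
  dia_left_C: "D_rule L [sDia\<^sub>C (fmD A) \<turnstile>\<^sub>C \<Pi>] (fmC (Dia\<^sub>C A) \<turnstile>\<^sub>C \<Pi>)" |
  dia_right_C: "D_rule L [X \<turnstile>\<^sub>D fmD A] (sDia\<^sub>C X \<turnstile>\<^sub>C fmC (Dia\<^sub>C A))" |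
  circ_right_I: "D_rule L [X \<turnstile>\<^sub>D sCirc\<^sub>I (fmI \<alpha>)] (X \<turnstile>\<^sub>D fmD (Circ\<^sub>I \<alpha>))" |
  circ_left_I: "D_rule L [sCirc\<^sub>I (fmI \<alpha>) \<turnstile>\<^sub>D X] (fmD (Circ\<^sub>I \<alpha>) \<turnstile>\<^sub>D X)" |
  circ_right_C: "D_rule L [X \<turnstile>\<^sub>D sCirc\<^sub>C (fmC \<xi>)] (X \<turnstile>\<^sub>D fmD (Circ\<^sub>C \<xi>))" |
  circ_left_C: "D_rule L [sCirc\<^sub>C (fmC \<xi>) \<turnstile>\<^sub>D X] (fmD (Circ\<^sub>C \<xi>) \<turnstile>\<^sub>D X)" |
  neg_left_I: "L \<noteq> TQBA \<Longrightarrow> D_rule L [sSim (fmI \<alpha>) \<turnstile>\<^sub>I \<Gamma>] (fmI (Sim \<alpha>) \<turnstile>\<^sub>I \<Gamma>)" |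
  neg_right_I: "L \<noteq> TQBA \<Longrightarrow> D_rule L [\<Gamma> \<turnstile>\<^sub>I sSim (fmI \<alpha>)] (\<Gamma> \<turnstile>\<^sub>I fmI (Sim \<alpha>))" |
  neg_left_C: "L \<noteq> TQBA \<Longrightarrow> D_rule L [sMinus (fmC \<xi>) \<turnstile>\<^sub>C \<Pi>] (fmC (Minus \<xi>) \<turnstile>\<^sub>C \<Pi>)" |
  neg_right_C: "L \<noteq> TQBA \<Longrightarrow> D_rule L [\<Pi> \<turnstile>\<^sub>C sMinus (fmC \<xi>)] (\<Pi> \<turnstile>\<^sub>C fmC (Minus \<xi>))" |
  circ_sim: "L \<noteq> TQBA \<Longrightarrow> D_rule L [X \<turnstile>\<^sub>D sCirc\<^sub>I (sSim \<Gamma>)] (X \<turnstile>\<^sub>D sNeg (sCirc\<^sub>I \<Gamma>))" |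
  circ_minus: "L \<noteq> TQBA \<Longrightarrow> D_rule L [X \<turnstile>\<^sub>D sCirc\<^sub>C (sMinus \<Pi>)] (X \<turnstile>\<^sub>D sNeg (sCirc\<^sub>C \<Pi>))" |
  cgri_I: "L \<in> {IA1, PRA} \<Longrightarrow> D_rule L [\<Gamma> \<inter>\<^sub>I \<Delta> \<turnstile>\<^sub>I \<Lambda>] (\<Delta> \<turnstile>\<^sub>I sSim \<Gamma> \<union>\<^sub>I \<Lambda>)" |
  cgri_C: "L \<in> {IA1, PRA} \<Longrightarrow> D_rule L [\<Pi> \<sqinter>\<^sub>C \<Sigma> \<turnstile>\<^sub>C \<Omega>] (\<Sigma> \<turnstile>\<^sub>C sMinus \<Pi> \<squnion>\<^sub>C \<Omega>)" |
  ia2_I: "L \<in> {IA2, PRA} \<Longrightarrow> D_rule L [\<Gamma> \<turnstile>\<^sub>I sBox\<^sub>I (X \<or>\<^sub>D Y)] (\<Gamma> \<turnstile>\<^sub>I sBox\<^sub>I X \<union>\<^sub>I sBox\<^sub>I Y)" |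
  ia2_C: "L \<in> {IA2, PRA} \<Longrightarrow> D_rule L [sDia\<^sub>C (X \<and>\<^sub>D Y) \<turnstile>\<^sub>C \<Pi>] (sDia\<^sub>C X \<sqinter>\<^sub>C sDia\<^sub>C Y \<turnstile>\<^sub>C \<Pi>)" |
  ia3: "L \<in> {IA3, PRA} \<Longrightarrow> D_rule L [X \<turnstile>\<^sub>D Y, W \<turnstile>\<^sub>D Z] (X \<and>\<^sub>D sCirc\<^sub>C (sDia\<^sub>C W) \<turnstile>\<^sub>D sCirc\<^sub>I (sBox\<^sub>I Y) \<or>\<^sub>D Z)"

text \<open>Requiring every derived sequent to be in the language (hence every premise, including the
  cut formulas) makes derivations range over the sequents of the respective calculus only.\<close>

inductive D_derivable :: "tqba_logic \<Rightarrow> seqt \<Rightarrow> bool" for L where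
  step: "D_rule L Ss S \<Longrightarrow> \<forall>S'\<in>set Ss. D_derivable L S' \<Longrightarrow> in_language L S \<Longrightarrow> D_derivable L S"

primrec transl :: "form \<Rightarrow> dform" where
  "transl (PVar p) = Var p" |
  "transl PTop = Top" |
  "transl PBot = Bot" |
  "transl (PNeg A) = Neg (transl A)" |
  "transl (PI A) = Circ\<^sub>I (Box\<^sub>I (transl A))" |
  "transl (PC A) = Circ\<^sub>C (Dia\<^sub>C (transl A))" |
  "transl (PAnd A B) = And (transl A) (transl B)" |
  "transl (POr A B) = Or (transl A) (transl B)"

end

theory Submission
  imports Defs
begin

text \<open>
  The display calculus is interpreted in the canonical frame of the Hilbert system, and a sequent
  \<open>A \<turnstile> B\<close> that is not derivable in the Hilbert system is refuted there.

  The Lindenbaum algebra itself is not a model: the residuals and the adjoints of \<open>\<circ>\<close>, which the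
  structural connectives denote, may fail to exist in it. It is replaced by the lattice of the
  up-sets of its prime filters. Negation becomes the Routley star
  \<open>P\<^sup>* = {A. \<not>A \<notin> P}\<close>, and \<open>I\<close> becomes the interior of the preorder
  \<open>R P Q \<longleftrightarrow> (\<forall>A. IA \<in> P \<longrightarrow> A \<in> Q)\<close>. The type \<open>D\<close> is interpreted by the up-sets of inclusion, the type
  \<open>K\<^sub>I\<close> by the up-sets of \<open>R\<close>, and \<open>K\<^sub>C\<close> by the up-sets of the preorder \<open>S x y \<longleftrightarrow> R y\<^sup>* x\<^sup>*\<close>, which
  are the negations of the up-sets of \<open>R\<close>. Since the up-sets of a preorder are closed under
  arbitrary unions and intersections, each set has a largest up-set inside it and a smallest one
  around it; all residuals, boxes and diamonds are instances of these two operations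
  (\<open>subset_interior\<close>, \<open>upclosure_subset\<close>), and both \<open>\<circ>\<close> are inclusions.

  What distinguishes the six logics is then one first-order condition on the frame for each
  additional axiom. The conditions are assumptions of the locale \<open>frame\<close>; they validate the additional
  rules of the display calculi (\<open>D_rule_sound\<close>), and the canonical frame satisfies them
  (\<open>canonical_frame\<close>). The rule that characterises \<open>IA3\<close> is not itself an inequality, but it
  yields the inequality \<open>A \<and> CB \<le> IA \<or> B\<close> (\<open>H_IA3\<close>), and this one has a frame condition. By the truth lemma
  (\<open>truth_lemma\<close>), the translation of a formula denotes the set of the prime filters that contain the
  formula, and an underivable sequent is refuted by a prime filter that contains its left side but
  not its right side (\<open>prime_extension\<close>).\<close>

section \<open>Up-sets of a preorder\<close>

definition upsets :: "'w set \<Rightarrow> ('w \<Rightarrow> 'w \<Rightarrow> bool) \<Rightarrow> 'w set set" where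
  "upsets W R = {U. U \<subseteq> W \<and> (\<forall>x\<in>U. \<forall>y. R x y \<longrightarrow> y \<in> U)}"

definition interior :: "'w set \<Rightarrow> ('w \<Rightarrow> 'w \<Rightarrow> bool) \<Rightarrow> 'w set \<Rightarrow> 'w set" where
  "interior W R X = {x \<in> W. \<forall>y. R x y \<longrightarrow> y \<in> X}"

definition upclosure :: "('w \<Rightarrow> 'w \<Rightarrow> bool) \<Rightarrow> 'w set \<Rightarrow> 'w set" where
  "upclosure R X = {y. \<exists>x\<in>X. R x y}"

locale preorder_on_set =
  fixes W :: "'w set" and R :: "'w \<Rightarrow> 'w \<Rightarrow> bool"
  assumes field: "R x y \<Longrightarrow> x \<in> W \<and> y \<in> W"
    and refl: "x \<in> W \<Longrightarrow> R x x"
    and trans: "R x y \<Longrightarrow> R y z \<Longrightarrow> R x z"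
begin

lemma upsets_closed [simp]:
  "{} \<in> upsets W R" "W \<in> upsets W R"
  "U \<in> upsets W R \<Longrightarrow> V \<in> upsets W R \<Longrightarrow> U \<inter> V \<in> upsets W R"
  "U \<in> upsets W R \<Longrightarrow> V \<in> upsets W R \<Longrightarrow> U \<union> V \<in> upsets W R"
  using field by (auto simp: upsets_def)

lemma interior_in [simp]: "interior W R X \<in> upsets W R"
  unfolding upsets_def interior_def using field trans by blast

lemma upclosure_in [simp]: "upclosure R X \<in> upsets W R"
  unfolding upsets_def upclosure_def using field trans by blast

lemma subset_interior: "U \<in> upsets W R \<Longrightarrow> U \<subseteq> interior W R X \<longleftrightarrow> U \<subseteq> X"
  using refl by (auto simp: upsets_def interior_def)

lemma upclosure_subset: "V \<in> upsets W R \<Longrightarrow> X \<subseteq> W \<Longrightarrow> upclosure R X \<subseteq> V \<longleftrightarrow> X \<subseteq> V"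
  unfolding upsets_def upclosure_def using refl by blast

text \<open>The upward closure of a difference is the co-implication of the algebra of up-sets.\<close>

lemma upclosure_diff_subset:
  "V \<in> upsets W R \<Longrightarrow> U \<subseteq> W \<Longrightarrow> upclosure R (U - X) \<subseteq> V \<longleftrightarrow> U \<subseteq> X \<union> V"
  by (subst upclosure_subset) auto

lemma upclosure_upset: "U \<in> upsets W R \<Longrightarrow> upclosure R U = U"
  unfolding upsets_def upclosure_def using refl by blast

lemma interior_upset: "U \<in> upsets W R \<Longrightarrow> interior W R U = U"
  using refl by (auto simp: upsets_def interior_def)

lemma interior_subset: "interior W R X \<subseteq> X"
  using refl by (auto simp: interior_def)

lemma subset_upclosure: "X \<subseteq> W \<Longrightarrow> X \<subseteq> upclosure R X"
  using refl by (auto simp: upclosure_def)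

end

section \<open>Frames and soundness of the display calculi\<close>

text \<open>The last four conditions correspond to the axiom \<open>CIA \<turnstile> IA\<close>, to excluded middle for \<open>IA\<close>, to the
  distribution of \<open>I\<close> over disjunction, and to \<open>A \<and> CB \<turnstile> IA \<or> B\<close>.\<close>

locale frame = le: preorder_on_set W le + R: preorder_on_set W R
  for W :: "'w set" and le R :: "'w \<Rightarrow> 'w \<Rightarrow> bool" +
  fixes star :: "'w \<Rightarrow> 'w" and L :: tqba_logic
  assumes star_in [simp]: "x \<in> W \<Longrightarrow> star x \<in> W"
    and star_star [simp]: "x \<in> W \<Longrightarrow> star (star x) = x"
    and star_antimono: "le x y \<Longrightarrow> le (star y) (star x)"
    and le_R: "le x y \<Longrightarrow> R x y"
    and five: "L \<noteq> TQBA \<Longrightarrow> R x y \<Longrightarrow> R (star y) (star x)"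
    and excluded_middle: "L \<in> {IA1, PRA} \<Longrightarrow> x \<in> W \<Longrightarrow> R (star x) x"
    and least_successor: "L \<in> {IA2, PRA} \<Longrightarrow> x \<in> W \<Longrightarrow> \<exists>y. R x y \<and> (\<forall>z. R x z \<longrightarrow> le y z)"
    and separation: "L \<in> {IA3, PRA} \<Longrightarrow> z \<in> W \<Longrightarrow> R x y \<Longrightarrow> R (star x) (star z) \<Longrightarrow> le x y \<or> le z x"
begin

text \<open>The upward closure for this preorder is the operation \<open>\<not>I\<not>\<close> (\<open>upclosure_S\<close>), so it interprets \<open>C\<close>.\<close>

definition S :: "'w \<Rightarrow> 'w \<Rightarrow> bool" where
  "S x y \<longleftrightarrow> x \<in> W \<and> y \<in> W \<and> R (star y) (star x)"

definition neg :: "'w set \<Rightarrow> 'w set" where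
  "neg X = {x \<in> W. star x \<notin> X}"

sublocale S: preorder_on_set W S
  by unfold_locales (auto simp: S_def intro: R.refl R.trans)

lemma le_S: "le x y \<Longrightarrow> S x y"
  using le.field le_R star_antimono by (auto simp: S_def)

text \<open>Beyond \<open>TQBA\<close>, the star reverses \<open>R\<close>. The algebras for \<open>K\<^sub>I\<close> and \<open>K\<^sub>C\<close> then coincide and are
  closed under negation (\<open>neg_in_R\<close>), which interprets \<open>\<sim>\<close> and \<open>-\<close>.\<close>

lemma S_eq_R: "L \<noteq> TQBA \<Longrightarrow> S = R"
  using five R.field by (fastforce simp: S_def fun_eq_iff)

lemma upsets_R_le [simp]: "U \<in> upsets W R \<Longrightarrow> U \<in> upsets W le"
  using le_R by (auto simp: upsets_def)

lemma upsets_S_le [simp]: "U \<in> upsets W S \<Longrightarrow> U \<in> upsets W le"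
  using le_S by (auto simp: upsets_def)

lemma upsets_subset: "U \<in> upsets W le \<Longrightarrow> U \<subseteq> W"
  by (simp add: upsets_def)

lemma neg_in [simp]: "U \<in> upsets W le \<Longrightarrow> neg U \<in> upsets W le"
  unfolding upsets_def neg_def using star_antimono le.field star_in by blast

lemma neg_in_R: "L \<noteq> TQBA \<Longrightarrow> U \<in> upsets W R \<Longrightarrow> neg U \<in> upsets W R"
  unfolding upsets_def neg_def using five R.field star_in by blast

lemma neg_subset: "neg X \<subseteq> W"
  by (auto simp: neg_def)

lemma neg_neg: "X \<subseteq> W \<Longrightarrow> neg (neg X) = X"
  by (auto simp: neg_def)

lemma neg_antimono: "X \<subseteq> Y \<Longrightarrow> neg Y \<subseteq> neg X"
  by (auto simp: neg_def)

lemma neg_galois_left: "X \<subseteq> W \<Longrightarrow> Y \<subseteq> W \<Longrightarrow> neg X \<subseteq> Y \<longleftrightarrow> neg Y \<subseteq> X"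
  by (metis neg_antimono neg_neg)

lemma neg_galois_right: "X \<subseteq> W \<Longrightarrow> Y \<subseteq> W \<Longrightarrow> X \<subseteq> neg Y \<longleftrightarrow> Y \<subseteq> neg X"
  by (metis neg_antimono neg_neg)

lemma neg_subset_neg: "X \<subseteq> W \<Longrightarrow> Y \<subseteq> W \<Longrightarrow> neg Y \<subseteq> neg X \<longleftrightarrow> X \<subseteq> Y"
  by (metis neg_antimono neg_neg)

lemma upclosure_S: "X \<subseteq> W \<Longrightarrow> upclosure S X = neg (interior W R (neg X))"
proof (intro set_eqI iffI)
  fix y assume X: "X \<subseteq> W" and "y \<in> upclosure S X"
  then obtain x where "x \<in> X" "x \<in> W" "y \<in> W" "R (star y) (star x)"
    by (auto simp: upclosure_def S_def)
  then show "y \<in> neg (interior W R (neg X))"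
    by (auto simp: neg_def interior_def)
next
  fix y assume "X \<subseteq> W" and "y \<in> neg (interior W R (neg X))"
  then obtain z where "y \<in> W" "R (star y) z" "z \<notin> neg X"
    by (auto simp: neg_def interior_def)
  moreover from this have "z \<in> W" "star z \<in> X"
    using R.field by (auto simp: neg_def)
  ultimately show "y \<in> upclosure S X"
    by (auto simp: upclosure_def S_def intro!: bexI[of _ "star z"])
qed

lemma upclosure_R: "X \<subseteq> W \<Longrightarrow> upclosure R X = neg (interior W S (neg X))"
proof (intro set_eqI iffI)
  fix y assume X: "X \<subseteq> W" and "y \<in> upclosure R X"
  then obtain x where "x \<in> X" "x \<in> W" "y \<in> W" "R x y"
    using R.field by (auto simp: upclosure_def)
  then show "y \<in> neg (interior W S (neg X))"
    by (auto simp: neg_def interior_def S_def intro!: exI[of _ "star x"])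
next
  fix y assume "X \<subseteq> W" and "y \<in> neg (interior W S (neg X))"
  then obtain z where "y \<in> W" "S (star y) z" "z \<notin> neg X"
    by (auto simp: neg_def interior_def)
  then show "y \<in> upclosure R X"
    by (auto simp: upclosure_def S_def neg_def)
qed

lemma modal_duality:
  assumes "X \<subseteq> W"
  shows "interior W R (neg X) = neg (upclosure S X)"
    and "interior W S (neg X) = neg (upclosure R X)"
    and "upclosure S (neg X) = neg (interior W R X)"
    and "upclosure R (neg X) = neg (interior W S X)"
proof -
  have "interior W R Y \<subseteq> W" "interior W S Y \<subseteq> W" for Y
    by (auto simp: interior_def)
  then show "interior W R (neg X) = neg (upclosure S X)"
    "interior W S (neg X) = neg (upclosure R X)"
    using assms by (simp_all add: upclosure_S upclosure_R neg_neg)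
  show "upclosure S (neg X) = neg (interior W R X)" "upclosure R (neg X) = neg (interior W S X)"
    using assms by (simp_all add: upclosure_S upclosure_R neg_neg neg_subset)
qed

lemma interior_neg:
  "L \<noteq> TQBA \<Longrightarrow> U \<in> upsets W R \<Longrightarrow> interior W R (neg U) = neg U"
  by (simp add: R.interior_upset neg_in_R)

text \<open>Excluded middle puts \<open>x\<close> above \<open>star x\<close>: an up-set of \<open>R\<close> that misses \<open>x\<close> misses \<open>star x\<close> too.\<close>

lemma neg_complement: "L \<in> {IA1, PRA} \<Longrightarrow> U \<in> upsets W R \<Longrightarrow> W \<subseteq> U \<union> neg U"
  using excluded_middle by (auto simp: upsets_def neg_def)

text \<open>Whether \<open>x\<close> lies in the interior of an up-set of \<open>le\<close> is decided at the least successor of \<open>x\<close>.\<close>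

lemma interior_R_Un:
  assumes "L \<in> {IA2, PRA}" and X: "X \<in> upsets W le" and Y: "Y \<in> upsets W le"
  shows "interior W R (X \<union> Y) \<subseteq> interior W R X \<union> interior W R Y"
proof
  fix x assume x: "x \<in> interior W R (X \<union> Y)"
  then have "x \<in> W" by (simp add: interior_def)
  then obtain y where "R x y" and y: "\<And>z. R x z \<Longrightarrow> le y z"
    using least_successor[OF assms(1)] by blast
  then have "y \<in> X \<union> Y" using x by (simp add: interior_def)
  then show "x \<in> interior W R X \<union> interior W R Y"
    using \<open>x \<in> W\<close> X Y y by (auto simp: interior_def upsets_def)
qed

text \<open>This is \<open>interior_R_Un\<close> read through negation, which exchanges interiors for \<open>R\<close> with upward
  closures for \<open>S\<close>.\<close>

lemma upclosure_S_Int: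
  assumes "L \<in> {IA2, PRA}" and X: "X \<in> upsets W le" and Y: "Y \<in> upsets W le"
  shows "upclosure S X \<inter> upclosure S Y \<subseteq> upclosure S (X \<inter> Y)"
proof -
  have "interior W R (neg X \<union> neg Y) \<subseteq> interior W R (neg X) \<union> interior W R (neg Y)"
    using assms by (simp add: interior_R_Un)
  moreover have "neg X \<union> neg Y = neg (X \<inter> Y)"
    by (auto simp: neg_def)
  moreover have "X \<inter> Y \<subseteq> W"
    using X by (auto simp: upsets_def)
  ultimately have "neg (upclosure S (X \<inter> Y)) \<subseteq> neg (upclosure S X) \<union> neg (upclosure S Y)"
    using X Y by (simp add: modal_duality(1) upsets_subset)
  moreover have "neg (upclosure S X) \<union> neg (upclosure S Y) = neg (upclosure S X \<inter> upclosure S Y)"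
    by (auto simp: neg_def)
  ultimately have "neg (upclosure S (X \<inter> Y)) \<subseteq> neg (upclosure S X \<inter> upclosure S Y)"
    by simp
  moreover have "upclosure S X \<inter> upclosure S Y \<subseteq> W" "upclosure S (X \<inter> Y) \<subseteq> W"
    by (auto simp: upclosure_def S_def)
  ultimately show ?thesis
    by (simp only: neg_subset_neg)
qed

lemma Int_upclosure_S_subset:
  assumes "L \<in> {IA3, PRA}" and "X \<in> upsets W le" and "Y \<in> upsets W le"
  shows "X \<inter> upclosure S Y \<subseteq> interior W R X \<union> Y"
proof
  fix x assume x: "x \<in> X \<inter> upclosure S Y"
  then obtain z where "x \<in> W" "z \<in> W" "z \<in> Y" "R (star x) (star z)"
    by (auto simp: upclosure_def S_def)
  then show "x \<in> interior W R X \<union> Y"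
    using x assms(2,3) separation[OF assms(1), of z x] by (fastforce simp: upsets_def interior_def)
qed

text \<open>The interiors in the clauses for \<open>Sim\<close> and \<open>Minus\<close> are the identity as soon as the calculus has
  these connectives; in general they keep the value inside the intended algebra.\<close>

primrec dval :: "(nat \<Rightarrow> 'w set) \<Rightarrow> dform \<Rightarrow> 'w set"
  and ival :: "(nat \<Rightarrow> 'w set) \<Rightarrow> iform \<Rightarrow> 'w set"
  and cval :: "(nat \<Rightarrow> 'w set) \<Rightarrow> cform \<Rightarrow> 'w set" where
  "dval V (Var p) = V p" |
  "dval V Top = W" |
  "dval V Bot = {}" |
  "dval V (Circ\<^sub>I \<alpha>) = ival V \<alpha>" |
  "dval V (Circ\<^sub>C \<xi>) = cval V \<xi>" |
  "dval V (Neg A) = neg (dval V A)" |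
  "dval V (And A B) = dval V A \<inter> dval V B" |
  "dval V (Or A B) = dval V A \<union> dval V B" |
  "ival V (Box\<^sub>I A) = interior W R (dval V A)" |
  "ival V One\<^sub>I = W" |
  "ival V Zero\<^sub>I = {}" |
  "ival V (Cap \<alpha> \<beta>) = ival V \<alpha> \<inter> ival V \<beta>" |
  "ival V (Cup \<alpha> \<beta>) = ival V \<alpha> \<union> ival V \<beta>" |
  "ival V (Sim \<alpha>) = interior W R (neg (ival V \<alpha>))" |
  "cval V (Dia\<^sub>C A) = upclosure S (dval V A)" |
  "cval V One\<^sub>C = W" |
  "cval V Zero\<^sub>C = {}" |
  "cval V (Sqcap \<xi> \<chi>) = cval V \<xi> \<inter> cval V \<chi>" |
  "cval V (Sqcup \<xi> \<chi>) = cval V \<xi> \<union> cval V \<chi>" |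
  "cval V (Minus \<xi>) = interior W S (neg (cval V \<xi>))"

primrec dsem :: "(nat \<Rightarrow> 'w set) \<Rightarrow> dstr \<Rightarrow> 'w set"
  and isem :: "(nat \<Rightarrow> 'w set) \<Rightarrow> istr \<Rightarrow> 'w set"
  and csem :: "(nat \<Rightarrow> 'w set) \<Rightarrow> cstr \<Rightarrow> 'w set" where
  "dsem V (fmD A) = dval V A" |
  "dsem V sBot = {}" |
  "dsem V sTop = W" |
  "dsem V (sCirc\<^sub>C \<Pi>) = csem V \<Pi>" |
  "dsem V (sCirc\<^sub>I \<Gamma>) = isem V \<Gamma>" |
  "dsem V (sNeg X) = neg (dsem V X)" |
  "dsem V (X \<and>\<^sub>D Y) = dsem V X \<inter> dsem V Y" |
  "dsem V (X \<or>\<^sub>D Y) = dsem V X \<union> dsem V Y" |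
  "dsem V (X \<succ>\<^sub>D Y) = upclosure le (dsem V Y - dsem V X)" |
  "dsem V (X \<rightarrow>\<^sub>D Y) = interior W le (- dsem V X \<union> dsem V Y)" |
  "isem V (fmI \<alpha>) = ival V \<alpha>" |
  "isem V (sBox\<^sub>I X) = interior W R (dsem V X)" |
  "isem V (sDia\<^sub>I X) = upclosure R (dsem V X)" |
  "isem V sZero\<^sub>I = {}" |
  "isem V sOne\<^sub>I = W" |
  "isem V (\<Gamma> \<inter>\<^sub>I \<Delta>) = isem V \<Gamma> \<inter> isem V \<Delta>" |
  "isem V (\<Gamma> \<union>\<^sub>I \<Delta>) = isem V \<Gamma> \<union> isem V \<Delta>" |
  "isem V (\<Gamma> \<succ>\<^sub>I \<Delta>) = upclosure R (isem V \<Delta> - isem V \<Gamma>)" |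
  "isem V (\<Gamma> \<rightarrow>\<^sub>I \<Delta>) = interior W R (- isem V \<Gamma> \<union> isem V \<Delta>)" |
  "isem V (sSim \<Gamma>) = interior W R (neg (isem V \<Gamma>))" |
  "csem V (fmC \<xi>) = cval V \<xi>" |
  "csem V (sDia\<^sub>C X) = upclosure S (dsem V X)" |
  "csem V (sBox\<^sub>C X) = interior W S (dsem V X)" |
  "csem V sZero\<^sub>C = {}" |
  "csem V sOne\<^sub>C = W" |
  "csem V (\<Pi> \<sqinter>\<^sub>C \<Sigma>) = csem V \<Pi> \<inter> csem V \<Sigma>" |
  "csem V (\<Pi> \<squnion>\<^sub>C \<Sigma>) = csem V \<Pi> \<union> csem V \<Sigma>" |
  "csem V (\<Pi> \<succ>\<^sub>C \<Sigma>) = upclosure S (csem V \<Sigma> - csem V \<Pi>)" |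
  "csem V (\<Pi> \<rightarrow>\<^sub>C \<Sigma>) = interior W S (- csem V \<Pi> \<union> csem V \<Sigma>)" |
  "csem V (sMinus \<Pi>) = interior W S (neg (csem V \<Pi>))"

primrec valid :: "(nat \<Rightarrow> 'w set) \<Rightarrow> seqt \<Rightarrow> bool" where
  "valid V (X \<turnstile>\<^sub>D Y) \<longleftrightarrow> dsem V X \<subseteq> dsem V Y" |
  "valid V (\<Gamma> \<turnstile>\<^sub>I \<Delta>) \<longleftrightarrow> isem V \<Gamma> \<subseteq> isem V \<Delta>" |
  "valid V (\<Pi> \<turnstile>\<^sub>C \<Sigma>) \<longleftrightarrow> csem V \<Pi> \<subseteq> csem V \<Sigma>"

context
  fixes V :: "nat \<Rightarrow> 'w set"
  assumes V: "\<And>p. V p \<in> upsets W le"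
begin

lemma val_in [simp]:
  "dval V A \<in> upsets W le" "ival V \<alpha> \<in> upsets W R" "cval V \<xi> \<in> upsets W S"
  using V by (induction A and \<alpha> and \<xi>) simp_all

lemma sem_in [simp]:
  "dsem V X \<in> upsets W le" "isem V \<Gamma> \<in> upsets W R" "csem V \<Pi> \<in> upsets W S"
  by (induction X and \<Gamma> and \<Pi>) simp_all

lemma sem_subset [simp]: "dsem V X \<subseteq> W" "isem V \<Gamma> \<subseteq> W" "csem V \<Pi> \<subseteq> W"
  by (simp_all add: upsets_subset)

lemma csem_in_R: "L \<noteq> TQBA \<Longrightarrow> csem V \<Pi> \<in> upsets W R"
  using sem_in(3)[of \<Pi>] by (simp add: S_eq_R)

text \<open>Each bidirectional rule is an instance of an adjunction, of the antitone involution \<open>neg\<close>, of the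
  duality between interior and upward closure, or of a law of lattices of sets.\<close>

lemma two_way_sound: "two_way L T T' \<Longrightarrow> valid V T \<longleftrightarrow> valid V T'"
proof (induction rule: two_way.induct)
qed (auto simp: le.subset_interior R.subset_interior S.subset_interior
    le.upclosure_subset R.upclosure_subset S.upclosure_subset
    le.upclosure_diff_subset R.upclosure_diff_subset S.upclosure_diff_subset
    neg_galois_left neg_galois_right neg_subset_neg modal_duality
    R.upclosure_upset S_eq_R csem_in_R Int_absorb2)

lemma D_rule_sound: "D_rule L Ts T \<Longrightarrow> \<forall>T'\<in>set Ts. valid V T' \<Longrightarrow> valid V T"
proof (induction rule: D_rule.induct)
  case (dia_box_C X Y)
  then have "upclosure S (dsem V X) \<subseteq> interior W S (dsem V Y)"
    by simp
  then show ?case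
    using S.subset_upclosure[OF sem_subset(1)[of X]] S.interior_subset[of "dsem V Y"] by simp
next
  case (dia_box_I X Y)
  then have "upclosure R (dsem V X) \<subseteq> interior W R (dsem V Y)"
    by simp
  then show ?case
    using R.subset_upclosure[OF sem_subset(1)[of X]] R.interior_subset[of "dsem V Y"] by simp
next
  case (box_left_I A X)
  then show ?case
    by (auto simp: interior_def)
next
  case (dia_right_C X A)
  then show ?case
    by (auto simp: upclosure_def)
next
  case (cgri_I \<Gamma> \<Delta> \<Lambda>)
  then have "isem V (sSim \<Gamma>) = neg (isem V \<Gamma>)"
    by (auto simp: interior_neg)
  moreover have "isem V \<Delta> \<subseteq> isem V \<Gamma> \<union> neg (isem V \<Gamma>)"
    by (rule order_trans[OF sem_subset(2) neg_complement[OF cgri_I(1) sem_in(2)]])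
  ultimately show ?case
    using cgri_I(2) by auto
next
  case (cgri_C \<Pi> \<Sigma> \<Omega>)
  then have L: "L \<noteq> TQBA"
    by auto
  then have "csem V (sMinus \<Pi>) = neg (csem V \<Pi>)"
    by (simp add: interior_neg S_eq_R csem_in_R)
  moreover have "csem V \<Sigma> \<subseteq> csem V \<Pi> \<union> neg (csem V \<Pi>)"
    by (rule order_trans[OF sem_subset(3) neg_complement[OF cgri_C(1) csem_in_R[OF L]]])
  ultimately show ?case
    using cgri_C(2) by auto
next
  case (ia2_I \<Gamma> X Y)
  then show ?case
    using interior_R_Un[of "dsem V X" "dsem V Y"] by auto
next
  case (ia2_C X Y \<Pi>)
  then show ?case
    using upclosure_S_Int[of "dsem V X" "dsem V Y"] by auto
next
  case (ia3 X Y U Z)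
  then have "dsem V X \<subseteq> dsem V Y" "upclosure S (dsem V U) \<subseteq> upclosure S (dsem V Z)"
    by (auto simp: upclosure_def)
  then show ?case
    using Int_upclosure_S_subset[OF ia3(1), of "dsem V Y" "dsem V Z"] by auto
qed (auto simp: two_way_sound modal_duality R.upclosure_upset S.upclosure_upset
    R.subset_interior S.upclosure_subset interior_neg S_eq_R csem_in_R)

lemma D_derivable_sound: "D_derivable L T \<Longrightarrow> valid V T"
  by (induction rule: D_derivable.induct) (metis D_rule_sound)

end

end

section \<open>Derivability in the Hilbert systems\<close>

lemma H_contrapose: "H_derivable L (PNeg A) B \<Longrightarrow> H_derivable L (PNeg B) A"
  by (rule rl_trans[OF rl_neg ax_dn2])

lemma H_contrapose': "H_derivable L A (PNeg B) \<Longrightarrow> H_derivable L B (PNeg A)"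
  by (rule rl_trans[OF ax_dn1 rl_neg])

lemma H_PNeg_PTop: "H_derivable L (PNeg PTop) PBot"
  by (rule H_contrapose[OF ax_top])

lemma H_PNeg_PBot: "H_derivable L PTop (PNeg PBot)"
  by (rule H_contrapose'[OF ax_bot])

lemma H_PAnd_mono:
  "H_derivable L A A' \<Longrightarrow> H_derivable L B B' \<Longrightarrow> H_derivable L (PAnd A B) (PAnd A' B')"
  by (rule rl_and[OF rl_trans[OF ax_and1] rl_trans[OF ax_and2]])

lemma H_PNeg_PAnd: "H_derivable L (PNeg (PAnd A B)) (POr (PNeg A) (PNeg B))"
  by (rule H_contrapose[OF rl_and[OF H_contrapose[OF ax_or1] H_contrapose[OF ax_or2]]])

lemma H_PNeg_POr: "H_derivable L (PAnd (PNeg A) (PNeg B)) (PNeg (POr A B))"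
  by (rule H_contrapose'[OF rl_or[OF H_contrapose'[OF ax_and1] H_contrapose'[OF ax_and2]]])

lemma H_PC_mono: "H_derivable L A B \<Longrightarrow> H_derivable L (PC A) (PC B)"
  by (rule rl_trans[OF ax_C1 rl_trans[OF rl_neg[OF rl_I_mono[OF rl_neg]] ax_C2]])

lemma H_PC_idem: "H_derivable L (PC (PC A)) (PC A)"
proof -
  have "H_derivable L (PI (PNeg A)) (PI (PNeg (PC A)))"
    by (rule rl_trans[OF ax_4 rl_I_mono[OF H_contrapose'[OF ax_C1]]])
  then show ?thesis
    by (rule rl_trans[OF ax_C1 rl_trans[OF rl_neg ax_C2]])
qed

text \<open>\<open>\<not>I\<not>IA\<close> is \<open>CIA\<close>, so contraposing \<open>CIA \<turnstile> IA\<close> gives \<open>\<not>IA \<turnstile> I\<not>IA\<close>. This is the form of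
  the axiom that makes the star reverse the accessibility relation of the canonical frame.\<close>

lemma H_TQBA5:
  assumes "L \<noteq> TQBA"
  shows "H_derivable L (PNeg A) (PI (PNeg (PI A)))"
  by (rule rl_trans[OF rl_neg[OF ax_T] H_contrapose[OF rl_trans[OF ax_C2 ax_5[OF assms]]]])

text \<open>The rule of \<open>IA3\<close> applies because \<open>I(A \<and> CB) \<turnstile> IIA\<close> and \<open>C(A \<and> CB) \<turnstile> CCB \<turnstile> CB\<close>.\<close>

lemma H_IA3:
  assumes "L \<in> {IA3, PRA}"
  shows "H_derivable L (PAnd A (PC B)) (POr (PI A) B)"
proof (rule rl_IC[OF assms])
  show "H_derivable L (PI (PAnd A (PC B))) (PI (POr (PI A) B))"
    by (rule rl_trans[OF rl_I_mono[OF ax_and1] rl_trans[OF ax_4 rl_I_mono[OF ax_or1]]])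
  show "H_derivable L (PC (PAnd A (PC B))) (PC (POr (PI A) B))"
    by (rule rl_trans[OF H_PC_mono[OF ax_and2] rl_trans[OF H_PC_idem H_PC_mono[OF ax_or2]]])
qed

section \<open>The canonical frame\<close>

definition H_filter :: "tqba_logic \<Rightarrow> form set \<Rightarrow> bool" where
  "H_filter L F \<longleftrightarrow> PTop \<in> F \<and> (\<forall>A\<in>F. \<forall>B\<in>F. PAnd A B \<in> F) \<and>
    (\<forall>A\<in>F. \<forall>B. H_derivable L A B \<longrightarrow> B \<in> F)"

definition prime_filters :: "tqba_logic \<Rightarrow> form set set" where
  "prime_filters L = {P. H_filter L P \<and> PBot \<notin> P \<and> (\<forall>A B. POr A B \<in> P \<longrightarrow> A \<in> P \<or> B \<in> P)}"

lemma H_filter_mono: "H_filter L F \<Longrightarrow> H_derivable L A B \<Longrightarrow> A \<in> F \<Longrightarrow> B \<in> F"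
  by (auto simp: H_filter_def)

lemma H_filter_PAnd: "H_filter L F \<Longrightarrow> PAnd A B \<in> F \<longleftrightarrow> A \<in> F \<and> B \<in> F"
  unfolding H_filter_def using ax_and1 ax_and2 by blast

lemma H_filter_PTop: "H_filter L F \<Longrightarrow> PTop \<in> F"
  by (auto simp: H_filter_def)

lemma principal_filter: "H_filter L {B. H_derivable L A B}"
  unfolding H_filter_def by (auto intro: ax_top rl_and rl_trans)

lemma adjoin_filter:
  assumes "H_filter L F"
  shows "H_filter L {D. \<exists>G\<in>F. H_derivable L (PAnd G A) D}" (is "H_filter L ?F")
proof -
  have "PAnd D E \<in> ?F" if D: "D \<in> ?F" and E: "E \<in> ?F" for D E
  proof -
    from D E obtain G G' where G: "G \<in> F" "H_derivable L (PAnd G A) D"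
      and G': "G' \<in> F" "H_derivable L (PAnd G' A) E" by blast
    have "H_derivable L (PAnd (PAnd G G') A) (PAnd G A)"
      "H_derivable L (PAnd (PAnd G G') A) (PAnd G' A)"
      by (rule H_PAnd_mono[OF ax_and1 ax_refl], rule H_PAnd_mono[OF ax_and2 ax_refl])
    then have "H_derivable L (PAnd (PAnd G G') A) (PAnd D E)"
      by (rule rl_and[OF rl_trans[OF _ G(2)] rl_trans[OF _ G'(2)]])
    then show ?thesis
      using G(1) G'(1) H_filter_PAnd[OF assms] by blast
  qed
  then show ?thesis
    unfolding H_filter_def using H_filter_PTop[OF assms] ax_top rl_trans by blast
qed

text \<open>A filter \<open>M\<close> that is maximal among those avoiding \<open>A\<close> is prime: adjoining \<open>B \<notin> M\<close> or
  \<open>D \<notin> M\<close> yields \<open>A\<close>, hence by distributivity so does adjoining \<open>B \<or> D\<close>.\<close>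

lemma prime_extension:
  assumes F: "H_filter L F" and A: "A \<notin> F"
  obtains P where "P \<in> prime_filters L" "F \<subseteq> P" "A \<notin> P"
proof -
  let ?\<F> = "{G. H_filter L G \<and> F \<subseteq> G \<and> A \<notin> G}"
  have "\<exists>M\<in>?\<F>. \<forall>G\<in>?\<F>. M \<subseteq> G \<longrightarrow> G = M"
  proof (rule subset_Zorn_nonempty)
    show "?\<F> \<noteq> {}"
      using F A by blast
  next
    fix \<C> assume ne: "\<C> \<noteq> {}" and chain: "subset.chain ?\<F> \<C>"
    then have C: "\<And>G. G \<in> \<C> \<Longrightarrow> H_filter L G \<and> F \<subseteq> G \<and> A \<notin> G"
      by (auto simp: subset.chain_def)
    have "H_filter L (\<Union>\<C>)"
      unfolding H_filter_def
    proof (intro conjI ballI allI impI)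
      show "PTop \<in> \<Union>\<C>"
        using ne C H_filter_PTop by blast
    next
      fix B D assume "B \<in> \<Union>\<C>" "D \<in> \<Union>\<C>"
      then obtain G G' where "G \<in> \<C>" "G' \<in> \<C>" "B \<in> G" "D \<in> G'"
        by blast
      moreover from this have "G \<subseteq> G' \<or> G' \<subseteq> G"
        using chain unfolding subset.chain_def by auto
      ultimately show "PAnd B D \<in> \<Union>\<C>"
        using C H_filter_PAnd by blast
    next
      fix B D assume "B \<in> \<Union>\<C>" "H_derivable L B D"
      then show "D \<in> \<Union>\<C>"
        using C H_filter_mono by blast
    qed
    then show "\<Union>\<C> \<in> ?\<F>"
      using ne C by blast
  qed
  then obtain M where M_in: "M \<in> ?\<F>" and M_max: "\<forall>G\<in>?\<F>. M \<subseteq> G \<longrightarrow> G = M"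
    by (rule bexE)
  from M_in have M: "H_filter L M" "F \<subseteq> M" "A \<notin> M"
    by simp_all
  have max: "G = M" if "H_filter L G" "A \<notin> G" "M \<subseteq> G" for G
    using M_max that M(2) by auto
  have avoid: "\<exists>G\<in>M. H_derivable L (PAnd G B) A" if B: "B \<notin> M" for B
  proof (rule ccontr)
    let ?G = "{D. \<exists>G\<in>M. H_derivable L (PAnd G B) D}"
    assume "\<not> ?thesis"
    moreover have "M \<subseteq> ?G"
      by (auto intro: ax_and1)
    ultimately have "?G = M"
      using adjoin_filter[OF M(1)] by (intro max) auto
    moreover have "B \<in> ?G"
      using H_filter_PTop[OF M(1)] ax_and2 by blast
    ultimately show False
      using B by simp
  qed
  have "B \<in> M \<or> D \<in> M" if BD: "POr B D \<in> M" for B D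
  proof (rule ccontr)
    assume "\<not> ?thesis"
    then obtain G G' where G: "G \<in> M" "H_derivable L (PAnd G B) A"
      and G': "G' \<in> M" "H_derivable L (PAnd G' D) A"
      using avoid[of B] avoid[of D] by blast
    let ?H = "PAnd G G'"
    have "H_derivable L (PAnd ?H B) (PAnd G B)" "H_derivable L (PAnd ?H D) (PAnd G' D)"
      by (rule H_PAnd_mono[OF ax_and1 ax_refl], rule H_PAnd_mono[OF ax_and2 ax_refl])
    then have "H_derivable L (POr (PAnd ?H B) (PAnd ?H D)) A"
      by (rule rl_or[OF rl_trans[OF _ G(2)] rl_trans[OF _ G'(2)]])
    then have "H_derivable L (PAnd ?H (POr B D)) A"
      by (rule rl_trans[OF ax_dist])
    moreover have "PAnd ?H (POr B D) \<in> M"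
      using G(1) G'(1) BD H_filter_PAnd[OF M(1)] by simp
    ultimately show False
      using M(1,3) H_filter_mono by blast
  qed
  moreover have "PBot \<notin> M"
    using M(1,3) H_filter_mono ax_bot by blast
  ultimately show thesis
    using that M by (auto simp: prime_filters_def)
qed

context
  fixes L :: tqba_logic
begin

lemma prime_filter_mono:
  "P \<in> prime_filters L \<Longrightarrow> H_derivable L A B \<Longrightarrow> A \<in> P \<Longrightarrow> B \<in> P"
  unfolding prime_filters_def using H_filter_mono by blast

lemma prime_filter_simps [simp]:
  assumes P: "P \<in> prime_filters L"
  shows "PTop \<in> P" and "PBot \<notin> P" and "PAnd A B \<in> P \<longleftrightarrow> A \<in> P \<and> B \<in> P"
    and "POr A B \<in> P \<longleftrightarrow> A \<in> P \<or> B \<in> P" and "PNeg (PNeg A) \<in> P \<longleftrightarrow> A \<in> P"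
    and "PC A \<in> P \<longleftrightarrow> PNeg (PI (PNeg A)) \<in> P"
proof -
  have F: "H_filter L P" and bot: "PBot \<notin> P"
    and or: "\<And>A B. POr A B \<in> P \<Longrightarrow> A \<in> P \<or> B \<in> P"
    using P by (auto simp: prime_filters_def)
  note mono = H_filter_mono[OF F]
  show "PTop \<in> P" "PBot \<notin> P" "PAnd A B \<in> P \<longleftrightarrow> A \<in> P \<and> B \<in> P"
    using bot H_filter_PTop[OF F] H_filter_PAnd[OF F] by auto
  show "POr A B \<in> P \<longleftrightarrow> A \<in> P \<or> B \<in> P"
    using or mono[OF ax_or1] mono[OF ax_or2] by blast
  show "PNeg (PNeg A) \<in> P \<longleftrightarrow> A \<in> P"
    using mono[OF ax_dn1] mono[OF ax_dn2] by blast
  show "PC A \<in> P \<longleftrightarrow> PNeg (PI (PNeg A)) \<in> P"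
    using mono[OF ax_C1] mono[OF ax_C2] by blast
qed

definition star :: "form set \<Rightarrow> form set" where
  "star P = {A. PNeg A \<notin> P}"

lemma in_star: "A \<in> star P \<longleftrightarrow> PNeg A \<notin> P"
  by (simp add: star_def)

definition incl :: "form set \<Rightarrow> form set \<Rightarrow> bool" where
  "incl P Q \<longleftrightarrow> P \<in> prime_filters L \<and> Q \<in> prime_filters L \<and> P \<subseteq> Q"

definition acc :: "form set \<Rightarrow> form set \<Rightarrow> bool" where
  "acc P Q \<longleftrightarrow> P \<in> prime_filters L \<and> Q \<in> prime_filters L \<and> (\<forall>A. PI A \<in> P \<longrightarrow> A \<in> Q)"

lemma star_prime_filter [simp]:
  assumes P: "P \<in> prime_filters L"
  shows "star P \<in> prime_filters L"
proof -
  note mono = prime_filter_mono[OF P]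
  have "PNeg PTop \<notin> P" "PNeg PBot \<in> P"
    using P mono[OF H_PNeg_PTop] mono[OF H_PNeg_PBot] by auto
  moreover have "PNeg A \<in> P \<or> PNeg B \<in> P" if "PNeg (PAnd A B) \<in> P" for A B
    using mono[OF H_PNeg_PAnd that] P by simp
  moreover have "PNeg (POr A B) \<in> P" if "PNeg A \<in> P" "PNeg B \<in> P" for A B
    using mono[OF H_PNeg_POr, of A B] that P by simp
  moreover have "PNeg A \<in> P" if "H_derivable L A B" "PNeg B \<in> P" for A B
    using mono[OF rl_neg[OF that(1)] that(2)] .
  ultimately show ?thesis
    unfolding prime_filters_def H_filter_def star_def by blast
qed

lemma necessary_filter:
  assumes P: "P \<in> prime_filters L"
  shows "H_filter L {A. PI A \<in> P}"
proof -
  note mono = prime_filter_mono[OF P]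
  have "PI (PAnd A B) \<in> P" if "PI A \<in> P" "PI B \<in> P" for A B
    using mono[OF ax_I_and2] that P by simp
  moreover have "PI PTop \<in> P"
    using mono[OF ax_I_top] P by simp
  ultimately show ?thesis
    unfolding H_filter_def using mono[OF rl_I_mono] by blast
qed

text \<open>When \<open>I\<close> distributes over disjunction, the filter of the necessary formulas is prime, and it is
  then the least successor.\<close>

lemma necessary_prime_filter:
  assumes L: "L \<in> {IA2, PRA}" and P: "P \<in> prime_filters L"
  shows "{A. PI A \<in> P} \<in> prime_filters L"
proof -
  note mono = prime_filter_mono[OF P]
  have "PI PBot \<notin> P"
    using mono[OF ax_T] P by fastforce
  moreover have "PI A \<in> P \<or> PI B \<in> P" if "PI (POr A B) \<in> P" for A B
    using mono[OF ax_I_or[OF L] that] P by simp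
  ultimately show ?thesis
    using necessary_filter[OF P] unfolding prime_filters_def by blast
qed

text \<open>If both inclusions fail, let \<open>A\<close> and \<open>B\<close> witness this. Then \<open>A \<and> CB\<close> belongs to \<open>P\<close>, because \<open>T\<close>
  is a witness for \<open>CB\<close>, whereas \<open>IA \<or> B\<close> does not, because \<open>Q\<close> refutes \<open>IA\<close>.\<close>

lemma canonical_separation:
  assumes L: "L \<in> {IA3, PRA}" and PQ: "acc P Q" and PT: "acc (star P) (star T)"
    and T: "T \<in> prime_filters L"
  shows "P \<subseteq> Q \<or> T \<subseteq> P"
proof (rule ccontr)
  assume "\<not> ?thesis"
  then obtain A B where A: "A \<in> P" "A \<notin> Q" and B: "B \<in> T" "B \<notin> P"
    by blast
  have P: "P \<in> prime_filters L"
    using PQ by (simp add: acc_def)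
  have "PNeg B \<notin> star T"
    using B(1) T by (simp add: star_def)
  then have "PI (PNeg B) \<notin> star P"
    using PT by (auto simp: acc_def)
  then have "PAnd A (PC B) \<in> P"
    using A(1) P by (simp add: star_def)
  then have "POr (PI A) B \<in> P"
    by (rule prime_filter_mono[OF P H_IA3[OF L]])
  then show False
    using A(2) B(2) PQ P by (auto simp: acc_def)
qed

lemma canonical_frame: "frame (prime_filters L) incl acc star L"
proof unfold_locales
  fix P Q T
  show "incl P Q \<Longrightarrow> P \<in> prime_filters L \<and> Q \<in> prime_filters L"
    "P \<in> prime_filters L \<Longrightarrow> incl P P"
    "incl P Q \<Longrightarrow> incl Q T \<Longrightarrow> incl P T"
    by (auto simp: incl_def)
  show "acc P Q \<Longrightarrow> P \<in> prime_filters L \<and> Q \<in> prime_filters L"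
    by (simp add: acc_def)
  show "acc P P" if "P \<in> prime_filters L"
    using that prime_filter_mono[OF that ax_T] by (auto simp: acc_def)
  show "acc P Q \<Longrightarrow> acc Q T \<Longrightarrow> acc P T"
    unfolding acc_def using prime_filter_mono[OF _ ax_4] by blast
  show "P \<in> prime_filters L \<Longrightarrow> star P \<in> prime_filters L"
    by simp
  show "star (star P) = P" if "P \<in> prime_filters L"
    using that by (auto simp: star_def)
  show "incl P Q \<Longrightarrow> incl (star Q) (star P)"
    by (auto simp: incl_def) (auto simp: star_def)
  show "incl P Q \<Longrightarrow> acc P Q"
    unfolding incl_def acc_def using prime_filter_mono[OF _ ax_T] by blast
  show "acc (star Q) (star P)" if "L \<noteq> TQBA" and PQ: "acc P Q"
  proof -
    have "PI (PNeg (PI A)) \<in> P" if "PNeg A \<in> P" for A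
      using PQ prime_filter_mono[OF _ H_TQBA5[OF \<open>L \<noteq> TQBA\<close>] that] by (simp add: acc_def)
    then have "PI A \<in> star Q \<Longrightarrow> A \<in> star P" for A
      using PQ by (auto simp: acc_def star_def)
    then show ?thesis
      using PQ by (simp add: acc_def)
  qed
  show "acc (star P) P" if L: "L \<in> {IA1, PRA}" and P: "P \<in> prime_filters L"
  proof -
    have "A \<in> P" if "PI A \<in> star P" for A
    proof -
      have "PI A \<in> P"
        using prime_filter_mono[OF P ax_em[OF L], of A] P that by (simp add: star_def)
      then show ?thesis
        by (rule prime_filter_mono[OF P ax_T])
    qed
    then show ?thesis
      using P by (simp add: acc_def)
  qed
  show "\<exists>Q. acc P Q \<and> (\<forall>T. acc P T \<longrightarrow> incl Q T)"
    if "L \<in> {IA2, PRA}" and P: "P \<in> prime_filters L"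
    using necessary_prime_filter[OF that] P by (intro exI[of _ "{A. PI A \<in> P}"]) (auto simp: acc_def incl_def)
  show "incl P Q \<or> incl T P"
    if "L \<in> {IA3, PRA}" "T \<in> prime_filters L" "acc P Q" "acc (star P) (star T)"
    using canonical_separation[OF that(1,3,4,2)] that(2,3) by (auto simp: incl_def acc_def)
qed

text \<open>The formulas that are necessary at \<open>P\<close> form a filter; if it avoids \<open>A\<close>, then so does some prime
  filter above it, which is a successor of \<open>P\<close>.\<close>

lemma interior_acc:
  "interior (prime_filters L) acc {P \<in> prime_filters L. A \<in> P} = {P \<in> prime_filters L. PI A \<in> P}"
proof -
  have "\<exists>Q. acc P Q \<and> A \<notin> Q" if P: "P \<in> prime_filters L" "PI A \<notin> P" for P
  proof -
    obtain Q where "Q \<in> prime_filters L" "{B. PI B \<in> P} \<subseteq> Q" "A \<notin> Q"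
      using prime_extension[OF necessary_filter[OF P(1)], of A] P(2) by auto
    then show ?thesis
      using P(1) by (auto simp: acc_def)
  qed
  then show ?thesis
    unfolding interior_def by (auto simp: acc_def)
qed

interpretation canonical: frame "prime_filters L" incl acc star L
  by (rule canonical_frame)

lemma neg_prime_filters:
  "canonical.neg {P \<in> prime_filters L. A \<in> P} = {P \<in> prime_filters L. PNeg A \<in> P}"
  by (auto simp: canonical.neg_def in_star)

lemma truth_lemma:
  "canonical.dval (\<lambda>p. {P \<in> prime_filters L. PVar p \<in> P}) (transl A) = {P \<in> prime_filters L. A \<in> P}"
proof (induction A)
  case (PNeg A)
  then show ?case
    by (simp add: neg_prime_filters)
next
  case (PC A)
  have "{P \<in> prime_filters L. A \<in> P} \<subseteq> prime_filters L"
    by blast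
  then show ?case
    using PC by (simp add: canonical.upclosure_S neg_prime_filters interior_acc cong: conj_cong)
qed (simp_all add: interior_acc Int_def Un_def conj_disj_distribL cong: conj_cong)

lemma prime_filters_sound:
  assumes "D_derivable L (fmD (transl A) \<turnstile>\<^sub>D fmD (transl B))" and "P \<in> prime_filters L" and "A \<in> P"
  shows "B \<in> P"
proof -
  let ?V = "\<lambda>p. {P \<in> prime_filters L. PVar p \<in> P}"
  have "?V p \<in> upsets (prime_filters L) incl" for p
    by (auto simp: upsets_def incl_def)
  then have "canonical.valid ?V (fmD (transl A) \<turnstile>\<^sub>D fmD (transl B))"
    using assms(1) by (rule canonical.D_derivable_sound)
  then show ?thesis
    using assms(2,3) by (auto simp: truth_lemma)
qed

end

theorem mainTheorem4:
  fixes L :: tqba_logic and A B :: form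
  assumes "D_derivable L (fmD (transl A) \<turnstile>\<^sub>D fmD (transl B))"
  shows "H_derivable L A B"
proof (rule ccontr)
  assume "\<not> H_derivable L A B"
  then obtain P where "P \<in> prime_filters L" "{E. H_derivable L A E} \<subseteq> P" "B \<notin> P"
    using prime_extension[OF principal_filter, of B L A] by auto
  then show False
    using prime_filters_sound[OF assms] ax_refl by blast
qed

end
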